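(* For every integer $d\ge d_0$ let $g_d\in\mathbb{R}[x]_{2d}$ be (the $g$-component of) an optimal solution of the semidefinite program $(\mathrm{SDP}_d)$ described in the context, and let $\bar g_d:\mathbf{B}\to\mathbb{R}$ be the piecewise polynomial $\bar g_d(x):=\max_{d_0\le k\le d} g_k(x)$. Then, as $d\to\infty$: (a) $g_d\to\lambda_{\min}$ in $L_1$ norm on $\mathbf{B}$ and in Lebesgue measure on $\mathbf{B}$; (b) $\bar g_d\uparrow\lambda_{\min}$ almost everywhere, almost uniformly, and in Lebesgue measure on $\mathbf{B}$.
   Context: Notation. $\mathbb{R}[x]_d$ is the space of real polynomials in $x$ of degree at most $d$ (similarly for other sets of variables); $\Sigma[x]_d$ is the cone of sums of squares of polynomials having degree at most $2d$ (similarly $\Sigma[x,u,v]_d$). $A\succeq 0$ means that the symmetric matrix $A$ is positive semidefinite. Setting. $x\in\mathbb{R}^n$, $u\in\mathbb{R}^p$, $v\in\mathbb{R}^m$. $P(x,u)$ is a given symmetric $m\times m$ matrix whose entries are real polynomials in $(x,u)$; $\deg P$ is the maximal degree of its entries. $\mathbf{U}=\{u\in\mathbb{R}^p: a_i(u)\ge 0,\ i=1,\dots,n_a\}$ is a nonempty compact set, with $a_i\in\mathbb{R}[u]$, and for some index $i^*$ one has $a_{i^*}(u)=R^2-u^Tu$. Put $a_0:=1$. $\mathbf{P}=\{x\in\mathbb{R}^n:\ P(x,u)\succeq 0\ \ \forall u\in\mathbf{U}\}$ is assumed bounded. $\mathbf{B}=\{x\in\mathbb{R}^n: b_j(x)\ge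 0,\ j=1,\dots,n_b\}$ is a compact set containing $\mathbf{P}$, with $b_j\in\mathbb{R}[x]$, and for some index $j^*$ one has $b_{j^*}(x)=R^2-x^Tx$. ($R$ is sufficiently large.) $\mathbf{V}=\{v\in\mathbb{R}^m: v^Tv=1\}$. The function $\lambda_{\min}:\mathbf{B}\to\mathbb{R}$ is $\lambda_{\min}(x)=\min_{u\in\mathbf{U}}\min_{v\in\mathbf{V}} v^TP(x,u)v$. Fix an integer $d_0$ with $2d_0\ge\max(2+\deg P,\max_i\deg a_i,\max_j\deg b_j)$. For each integer $d\ge d_0$, $(\mathrm{SDP}_d)$ is the problem of maximizing $\int_{\mathbf{B}} g(x)\,dx$ over polynomials $g\in\mathbb{R}[x]_{2d}$, $r\in\mathbb{R}[x,u,v]_{2d_r}$, $s_i\in\Sigma[x,u,v]_{d_{s_i}}$ ($i=0,\dots,n_a$), $t_j\in\Sigma[x,u,v]_{d_{t_j}}$ ($j=1,\dots,n_b$) subject to the polynomial identity $$v^TP(x,u)v-g(x)=r(x,u,v)(1-v^Tv)+\sum_{i=0}^{n_a}s_i(x,u,v)a_i(u)+\sum_{j=1}^{n_b}t_j(x,u,v)b_j(x)\qquad\forall (x,u,v),$$ where the degree bounds (which depend on $d$) are fixed with $d_r\ge d-1$, $d_{s_i}\ge d-\lceil(\deg a_i)/2\rceil$, $d_{t_j}\ge d-\lceil(\deg b_j)/2\rceil$. Modes of convergence on $\mathbf{B}$ ($\mathrm{vol}$ is Lebesgue volume). $g_d\to g$ in $L_1$ norm: $\int_{\mathbf{B}}|g-g_d|\,dx\to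 0$. In Lebesgue measure: for every $\varepsilon>0$, $\mathrm{vol}\{x\in\mathbf{B}:|g(x)-g_d(x)|\ge\varepsilon\}\to 0$. Almost everywhere: pointwise outside a set of volume $0$. Almost uniformly: for every $\varepsilon>0$ there is $\mathbf{A}\subset\mathbf{B}$ with $\mathrm{vol}\,\mathbf{A}<\varepsilon$ and $g_d\to g$ uniformly on $\mathbf{B}\setminus\mathbf{A}$. The notation $g_d\uparrow g$ means $g_d\to g$ (in the stated mode) together with $g_d(x)\le g_{d+1}(x)$ for all $d$ (and all $x\in\mathbf{B}$). *)

theory Defs
  imports "HOL-Analysis.Analysis" "HOL-Library.Poly_Mapping"
begin

text \<open>The variables are indexed by a finite type. A monomial is its exponent vector, and a
  polynomial is the finitely supported family of its coefficients; the ring operations are those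
  of \<^theory>\<open>HOL-Library.Poly_Mapping\<close>.\<close>

type_synonym 'k rpoly = "('k \<Rightarrow>\<^sub>0 nat) \<Rightarrow>\<^sub>0 real"

definition peval :: "'k::finite rpoly \<Rightarrow> ('k \<Rightarrow> real) \<Rightarrow> real" where
  "peval p z = (\<Sum>m\<in>Poly_Mapping.keys p. Poly_Mapping.lookup p m * (\<Prod>k\<in>UNIV. z k ^ Poly_Mapping.lookup m k))"

text \<open>Total degree, with the convention that the zero polynomial has degree 0.\<close>

definition tdeg :: "'k::finite rpoly \<Rightarrow> nat" where
  "tdeg p = Max (insert 0 ((\<lambda>m. \<Sum>k\<in>UNIV. Poly_Mapping.lookup m k) ` Poly_Mapping.keys p))"

definition polys_upto :: "nat \<Rightarrow> 'k::finite rpoly set" where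
  "polys_upto d = {p. tdeg p \<le> d}"

definition sos_upto :: "nat \<Rightarrow> 'k::finite rpoly set" where
  "sos_upto d = {p. (\<exists>qs. p = (\<Sum>q\<leftarrow>qs. q\<^sup>2)) \<and> tdeg p \<le> 2 * d}"

text \<open>Polynomials in several groups of variables use sum types as index types.\<close>

abbreviation vars2 :: "real^'n \<Rightarrow> real^'p \<Rightarrow> 'n + 'p \<Rightarrow> real" where
  "vars2 x u \<equiv> case_sum (($) x) (($) u)"

abbreviation vars3 :: "real^'n \<Rightarrow> real^'p \<Rightarrow> real^'m \<Rightarrow> 'n + 'p + 'm \<Rightarrow> real" where
  "vars3 x u v \<equiv> case_sum (($) x) (case_sum (($) u) (($) v))"

type_synonym ('n, 'p, 'm) pmat = "(('n + 'p) rpoly)^'m^'m"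

definition mat_eval ::
    "('n::finite, 'p::finite, 'm::finite) pmat \<Rightarrow> real^'n \<Rightarrow> real^'p \<Rightarrow> real^'m^'m" where
  "mat_eval P x u = (\<chi> i j. peval (P $ i $ j) (vars2 x u))"

definition mat_deg :: "('n::finite, 'p::finite, 'm::finite) pmat \<Rightarrow> nat" where
  "mat_deg P = Max {tdeg (P $ i $ j) | i j. True}"

definition pos_semidef :: "real^'m^'m \<Rightarrow> bool" where
  "pos_semidef A \<longleftrightarrow> transpose A = A \<and> (\<forall>v. 0 \<le> v \<bullet> (A *v v))"

definition nonneg_set :: "nat \<Rightarrow> (nat \<Rightarrow> 'k::finite rpoly) \<Rightarrow> (real^'k) set" where
  "nonneg_set N a = {z. \<forall>i\<in>{1..N}. 0 \<le> peval (a i) (($) z)}"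

definition robust_set ::
    "('n::finite, 'p::finite, 'm::finite) pmat \<Rightarrow> (real^'p) set \<Rightarrow> (real^'n) set" where
  "robust_set P U = {x. \<forall>u\<in>U. pos_semidef (mat_eval P x u)}"

definition unit_vectors :: "(real^'m) set" where
  "unit_vectors = {v. v \<bullet> v = 1}"

text \<open>Both infima are minima when \<open>U\<close> is nonempty and compact; see \<open>lambda_min_attained\<close> below.\<close>

definition lambda_min ::
    "('n::finite, 'p::finite, 'm::finite) pmat \<Rightarrow> (real^'p) set \<Rightarrow> real^'n \<Rightarrow> real" where
  "lambda_min P U x = (INF u\<in>U. INF v\<in>unit_vectors. v \<bullet> (mat_eval P x u *v v))"

definition sdp_feasible ::
    "('n::finite, 'p::finite, 'm::finite) pmat \<Rightarrow> nat \<Rightarrow> (nat \<Rightarrow> 'p rpoly) \<Rightarrow>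
     nat \<Rightarrow> (nat \<Rightarrow> 'n rpoly) \<Rightarrow> nat \<Rightarrow> nat \<Rightarrow> (nat \<Rightarrow> nat) \<Rightarrow> (nat \<Rightarrow> nat) \<Rightarrow>
     'n rpoly \<Rightarrow> ('n + 'p + 'm) rpoly \<Rightarrow> (nat \<Rightarrow> ('n + 'p + 'm) rpoly) \<Rightarrow>
     (nat \<Rightarrow> ('n + 'p + 'm) rpoly) \<Rightarrow> bool" where
  "sdp_feasible P na a nb b d dr ds dt g r s t \<longleftrightarrow>
     g \<in> polys_upto (2 * d) \<and>
     r \<in> polys_upto (2 * dr) \<and>
     (\<forall>i\<in>{0..na}. s i \<in> sos_upto (ds i)) \<and>
     (\<forall>j\<in>{1..nb}. t j \<in> sos_upto (dt j)) \<and>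
     (\<forall>x u v. v \<bullet> (mat_eval P x u *v v) - peval g (($) x) =
        peval r (vars3 x u v) * (1 - v \<bullet> v)
        + (\<Sum>i=0..na. peval (s i) (vars3 x u v) * peval (a i) (($) u))
        + (\<Sum>j=1..nb. peval (t j) (vars3 x u v) * peval (b j) (($) x)))"

definition sdp_objective :: "(real^'n::finite) set \<Rightarrow> 'n rpoly \<Rightarrow> real" where
  "sdp_objective B g = (LINT x:B|lebesgue. peval g (($) x))"

definition sdp_optimal ::
    "('n::finite, 'p::finite, 'm::finite) pmat \<Rightarrow> nat \<Rightarrow> (nat \<Rightarrow> 'p rpoly) \<Rightarrow>
     nat \<Rightarrow> (nat \<Rightarrow> 'n rpoly) \<Rightarrow> nat \<Rightarrow> nat \<Rightarrow> (nat \<Rightarrow> nat) \<Rightarrow> (nat \<Rightarrow> nat) \<Rightarrow>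
     'n rpoly \<Rightarrow> ('n + 'p + 'm) rpoly \<Rightarrow> (nat \<Rightarrow> ('n + 'p + 'm) rpoly) \<Rightarrow>
     (nat \<Rightarrow> ('n + 'p + 'm) rpoly) \<Rightarrow> bool" where
  "sdp_optimal P na a nb b d dr ds dt g r s t \<longleftrightarrow>
     sdp_feasible P na a nb b d dr ds dt g r s t \<and>
     (\<forall>g' r' s' t'. sdp_feasible P na a nb b d dr ds dt g' r' s' t' \<longrightarrow>
        sdp_objective (nonneg_set nb b) g' \<le> sdp_objective (nonneg_set nb b) g)"

text \<open>The library's integral and measure return 0 for non-integrable functions and for
  non-measurable sets; the integrability and measurability conditions exclude these degenerate
  cases. They are only required eventually since the sequences of interest start at some
  positive index.\<close>

definition converges_L1_on ::
    "'a::euclidean_space set \<Rightarrow> (nat \<Rightarrow> 'a \<Rightarrow> real) \<Rightarrow> ('a \<Rightarrow> real) \<Rightarrow> bool" where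
  "converges_L1_on S f l \<longleftrightarrow>
     (\<forall>\<^sub>F d in sequentially. set_integrable lebesgue S (\<lambda>x. l x - f d x)) \<and>
     (\<lambda>d. LINT x:S|lebesgue. \<bar>l x - f d x\<bar>) \<longlonglongrightarrow> 0"

definition converges_in_measure_on ::
    "'a::euclidean_space set \<Rightarrow> (nat \<Rightarrow> 'a \<Rightarrow> real) \<Rightarrow> ('a \<Rightarrow> real) \<Rightarrow> bool" where
  "converges_in_measure_on S f l \<longleftrightarrow> (\<forall>\<epsilon>>0.
     (\<forall>\<^sub>F d in sequentially. {x\<in>S. \<epsilon> \<le> \<bar>l x - f d x\<bar>} \<in> lmeasurable) \<and>
     (\<lambda>d. measure lebesgue {x\<in>S. \<epsilon> \<le> \<bar>l x - f d x\<bar>}) \<longlonglongrightarrow> 0)"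

definition converges_AE_on ::
    "'a::euclidean_space set \<Rightarrow> (nat \<Rightarrow> 'a \<Rightarrow> real) \<Rightarrow> ('a \<Rightarrow> real) \<Rightarrow> bool" where
  "converges_AE_on S f l \<longleftrightarrow> (AE x in lebesgue. x \<in> S \<longrightarrow> (\<lambda>d. f d x) \<longlonglongrightarrow> l x)"

definition converges_almost_uniformly_on ::
    "'a::euclidean_space set \<Rightarrow> (nat \<Rightarrow> 'a \<Rightarrow> real) \<Rightarrow> ('a \<Rightarrow> real) \<Rightarrow> bool" where
  "converges_almost_uniformly_on S f l \<longleftrightarrow> (\<forall>\<epsilon>>0. \<exists>A\<subseteq>S.
     A \<in> lmeasurable \<and> measure lebesgue A < \<epsilon> \<and> uniform_limit (S - A) f l sequentially)"

definition nondecreasing_from_on ::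
    "nat \<Rightarrow> 'a set \<Rightarrow> (nat \<Rightarrow> 'a \<Rightarrow> real) \<Rightarrow> bool" where
  "nondecreasing_from_on d0 S f \<longleftrightarrow> (\<forall>d\<ge>d0. \<forall>x\<in>S. f d x \<le> f (Suc d) x)"

definition running_max ::
    "nat \<Rightarrow> (nat \<Rightarrow> 'n::finite rpoly) \<Rightarrow> nat \<Rightarrow> real^'n \<Rightarrow> real" where
  "running_max d0 g d x = Max ((\<lambda>k. peval (g k) (($) x)) ` {d0..d})"

lemma continuous_on_peval:
  assumes "\<And>k. continuous_on S (\<lambda>w. f w k)"
  shows "continuous_on S (\<lambda>w. peval p (f w))"
  unfolding peval_def by (intro continuous_intros assms)

lemma continuous_on_mat_eval_form:
  fixes P :: "('n::finite, 'p::finite, 'm::finite) pmat"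
  shows "continuous_on UNIV (\<lambda>(x, u, v). v \<bullet> (mat_eval P x u *v v))"
proof -
  have *: "continuous_on UNIV (\<lambda>w::(real^'n) \<times> (real^'p) \<times> (real^'m).
      vars2 (fst w) (fst (snd w)) k)" for k
    by (cases k) (auto intro!: continuous_intros)
  show ?thesis
    unfolding mat_eval_def inner_vec_def matrix_vector_mult_def case_prod_beta
    by (simp, intro continuous_intros continuous_on_peval *)
qed

lemma compact_unit_vectors: "compact (unit_vectors :: (real^'m) set)"
proof -
  have "unit_vectors = (sphere 0 1 :: (real^'m) set)"
    by (auto simp: unit_vectors_def norm_eq_1)
  then show ?thesis using compact_sphere by metis
qed

lemma unit_vectors_nonempty: "unit_vectors \<noteq> ({} :: (real^'m) set)"
proof -
  obtain v :: "real^'m" where "norm v = 1"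
    using vector_choose_size[of 1] by auto
  then show ?thesis by (auto simp: unit_vectors_def norm_eq_1)
qed

lemma lambda_min_attained:
  fixes P :: "('n::finite, 'p::finite, 'm::finite) pmat"
  assumes "compact U" "U \<noteq> {}"
  shows "\<exists>u\<in>U. \<exists>v\<in>unit_vectors. lambda_min P U x = v \<bullet> (mat_eval P x u *v v) \<and>
    (\<forall>u'\<in>U. \<forall>v'\<in>unit_vectors. v \<bullet> (mat_eval P x u *v v) \<le> v' \<bullet> (mat_eval P x u' *v v'))"
proof -
  let ?V = "unit_vectors :: (real^'m) set"
  define q where "q u v = v \<bullet> (mat_eval P x u *v v)" for u v
  have "continuous_on (U \<times> ?V) ((\<lambda>(x, u, v). v \<bullet> (mat_eval P x u *v v)) \<circ> (\<lambda>w. (x, w)))"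
    by (intro continuous_on_compose continuous_intros
        continuous_on_subset[OF continuous_on_mat_eval_form]) auto
  then have "continuous_on (U \<times> ?V) (\<lambda>w. q (fst w) (snd w))"
    by (simp add: q_def o_def case_prod_beta)
  moreover have "compact (U \<times> ?V)" "U \<times> ?V \<noteq> {}"
    using assms compact_unit_vectors unit_vectors_nonempty by (auto intro: compact_Times)
  ultimately obtain w where "w \<in> U \<times> ?V"
      and "\<forall>w'\<in>U \<times> ?V. q (fst w) (snd w) \<le> q (fst w') (snd w')"
    using continuous_attains_inf by blast
  then obtain u v where uv: "u \<in> U" "v \<in> ?V"
      and le: "\<And>u' v'. u' \<in> U \<Longrightarrow> v' \<in> ?V \<Longrightarrow> q u v \<le> q u' v'"
    by force
  have inner_le: "q u v \<le> (INF v'\<in>?V. q u' v')" if "u' \<in> U" for u'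
    using unit_vectors_nonempty le that by (auto intro!: cINF_greatest)
  have "bdd_below (q u ` ?V)"
    using le uv by (auto intro!: bdd_belowI2)
  then have inner: "(INF v'\<in>?V. q u v') \<le> q u v"
    using uv by (auto intro: cINF_lower)
  have "bdd_below ((\<lambda>u'. INF v'\<in>?V. q u' v') ` U)"
    using inner_le by (auto intro!: bdd_belowI2)
  then have "(INF u'\<in>U. INF v'\<in>?V. q u' v') \<le> q u v"
    using uv inner by (auto intro: cINF_lower2)
  moreover have "q u v \<le> (INF u'\<in>U. INF v'\<in>?V. q u' v')"
    by (rule cINF_greatest[OF assms(2) inner_le])
  ultimately have "lambda_min P U x = q u v"
    by (simp add: lambda_min_def q_def)
  with uv le show ?thesis unfolding q_def by blast
qed

end

theory Submission
  imports Defs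
begin

text \<open>Why the optimal solutions converge: a feasible \<open>g\<close> lies below \<open>lambda_min P U\<close> on \<open>B\<close>, since its
certificate, evaluated at a minimizing pair \<open>(u, v)\<close>, is a sum of nonnegative terms
(\<open>feasible_le_lambda_min\<close>). So maximizing the integral of \<open>g\<close> is the same as minimizing the \<open>L1\<close> distance
from \<open>lambda_min P U\<close>. That function is continuous, so by Stone--Weierstrass there are polynomials
strictly below it and arbitrarily close to it. Each of them is feasible for all large \<open>d\<close>
(\<open>eventually_feasible\<close>), and optimality forces the distance of \<open>g d\<close> to 0 (\<open>optimal_L1_convergence\<close>).
Markov's inequality gives convergence in measure. The running maximum lies between \<open>g d\<close> and the limit,
so it converges in measure as well, and being monotone it converges almost uniformly
(\<open>monotone_in_measure_imp_almost_uniformly\<close>) and hence almost everywhere.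

Feasibility for large \<open>d\<close> is Putinar's Positivstellensatz (\<open>putinar\<close>), which is proved here by elementary
approximation. Let \<open>f\<close> be positive where all constraints \<open>g\<close> are nonnegative, and let the constraints
be scaled so that they are at most 1 on a box containing that set. For a suitable exponent, subtracting from \<open>f\<close> a
multiple of the sum of the \<open>(1 - g) ^ (2 * k) * g\<close>, which stays within the quadratic module, makes the
difference positive on the whole box (\<open>penalized_positive\<close>). A polynomial that is positive on a box has
nonnegative coefficients in the tensor Bernstein basis of high degree (\<open>bernstein_coeffs_nonneg\<close>).
Up to constants the basis elements are products of the bounds \<open>c + w $ i\<close> and \<open>c - w $ i\<close>, and these lie in the quadratic
module of the single ball constraint \<open>N - w \<bullet> w\<close>. A quadratic module with one generator is closed under
products, so it contains the difference.\<close>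

section \<open>Evaluation of polynomials\<close>

definition monom_eval :: "('k::finite \<Rightarrow>\<^sub>0 nat) \<Rightarrow> ('k \<Rightarrow> real) \<Rightarrow> real" where
  "monom_eval m z = (\<Prod>k\<in>UNIV. z k ^ Poly_Mapping.lookup m k)"

lemma monom_eval_add: "monom_eval (m + n) z = monom_eval m z * monom_eval n z"
  by (simp add: monom_eval_def lookup_add power_add prod.distrib)

lemma peval_eq_sum:
  assumes "finite K" "Poly_Mapping.keys p \<subseteq> K"
  shows "peval p z = (\<Sum>m\<in>K. Poly_Mapping.lookup p m * monom_eval m z)"
  unfolding peval_def monom_eval_def[symmetric]
  by (rule sum.mono_neutral_left[OF assms]) (auto simp: in_keys_iff)

lemma peval_add: "peval (p + q) z = peval p z + peval q z"
proof -
  let ?K = "Poly_Mapping.keys p \<union> Poly_Mapping.keys q"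
  have "finite ?K" "Poly_Mapping.keys (p + q) \<subseteq> ?K"
    by (auto dest: subsetD[OF Poly_Mapping.keys_add])
  then show ?thesis
    by (simp add: peval_eq_sum[of ?K] lookup_add sum.distrib distrib_right)
qed

lemma peval_zero [simp]: "peval 0 z = 0"
  by (simp add: peval_def)

lemma peval_sum: "peval (\<Sum>i\<in>I. f i) z = (\<Sum>i\<in>I. peval (f i) z)"
  by (induction I rule: infinite_finite_induct) (auto simp: peval_add)

lemma peval_single: "peval (Poly_Mapping.single m c) z = c * monom_eval m z"
  by (subst peval_eq_sum[of "{m}"]) auto

lemma sum_single_keys: "(\<Sum>m\<in>Poly_Mapping.keys p. Poly_Mapping.single m (Poly_Mapping.lookup p m)) = p"
  by (rule poly_mapping_eqI) (auto simp: lookup_sum lookup_single when_def in_keys_iff)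

lemma peval_mult: "peval (p * q) z = peval p z * peval q z"
proof -
  let ?s = "\<lambda>p m. Poly_Mapping.single m (Poly_Mapping.lookup p m)"
  let ?S = "\<lambda>p. \<Sum>m\<in>Poly_Mapping.keys p. ?s p m"
  have "peval (?S p * ?S q) z = peval (?S p) z * peval (?S q) z"
    unfolding sum_product peval_sum
    by (simp add: mult_single peval_single monom_eval_add algebra_simps)
  then show ?thesis by (simp only: sum_single_keys)
qed

lemma peval_power2: "peval (q\<^sup>2) z = (peval q z)\<^sup>2"
  by (simp add: power2_eq_square peval_mult)

lemma peval_one [simp]: "peval 1 z = 1"
  unfolding single_one[symmetric] peval_single by (simp add: monom_eval_def)

lemma real_polynomial_function_peval:
  assumes "\<And>k. real_polynomial_function (\<lambda>w. f w k)"
  shows "real_polynomial_function (\<lambda>w. peval p (f w))"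
  unfolding peval_def
  by (intro real_polynomial_function_sum real_polynomial_function.intros
      real_polynomial_function_prod real_polynomial_function_power assms) auto

lemma real_polynomial_function_nth [intro]: "real_polynomial_function (\<lambda>w::real^'k. w $ k)"
  by (rule real_polynomial_function.intros(1)) (rule bounded_linear_vec_nth)

text \<open>This translates Stone--Weierstrass approximants and Positivstellensatz certificates, which are
obtained as functions, into the coefficient families over which the semidefinite programs range.\<close>

lemma real_polynomial_function_imp_peval:
  fixes f :: "real^'k \<Rightarrow> real"
  assumes "real_polynomial_function f"
  shows "\<exists>p. \<forall>w. f w = peval p (($) w)"
  using assms
proof (induction f rule: real_polynomial_function.induct)
  case (linear f)
  define p :: "'k rpoly" where "p = (\<Sum>k\<in>UNIV. Poly_Mapping.single (Poly_Mapping.single k 1) (f (axis k 1)))"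
  have mon: "monom_eval (Poly_Mapping.single k 1) (($) w) = w $ k" for k :: 'k and w :: "real^'k"
  proof -
    have "monom_eval (Poly_Mapping.single k 1) (($) w) = (\<Prod>j\<in>UNIV. if j = k then w $ k else 1)"
      unfolding monom_eval_def by (rule prod.cong) (auto simp: lookup_single when_def)
    then show ?thesis by simp
  qed
  have "f w = peval p (($) w)" for w
  proof -
    interpret bounded_linear f by fact
    have "f w = f (\<Sum>k\<in>UNIV. w $ k *s axis k 1)" by (simp add: basis_expansion)
    also have "\<dots> = peval p (($) w)"
      by (simp add: p_def peval_sum peval_single mon sum scaleR scalar_mult_eq_scaleR mult.commute
          flip: One_nat_def)
    finally show ?thesis .
  qed
  then show ?case by blast
next
  case (const c)
  have "c = peval (Poly_Mapping.single 0 c) (($) w)" for w :: "real^'k"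
    by (simp add: peval_single monom_eval_def)
  then show ?case by blast
next
  case (add f g)
  then show ?case by (metis peval_add)
next
  case (mult f g)
  then show ?case by (metis peval_mult)
qed

section \<open>Bernstein expansions of monomials\<close>

text \<open>The coefficients of \<open>y ^ j\<close> in the Bernstein basis of degree \<open>k\<close>. When \<open>k\<close> grows they approach
\<open>(i / k) ^ j\<close>, the values of the monomial on the uniform grid.\<close>

definition bernstein_coeff :: "nat \<Rightarrow> nat \<Rightarrow> nat \<Rightarrow> real" where
  "bernstein_coeff k j i = real (i choose j) / real (k choose j)"

text \<open>Multiply \<open>y ^ j\<close> by the expansion of \<open>1 = (y + (1 - y)) ^ (k - j)\<close> and collect terms.\<close>

lemma monomial_eq_sum_Bernstein:
  assumes "j \<le> k"
  shows "y ^ j = (\<Sum>i\<le>k. bernstein_coeff k j i * Bernstein k i y)"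
proof -
  have "(\<Sum>i\<le>k. bernstein_coeff k j i * Bernstein k i y)
      = (\<Sum>i\<in>{j..k}. bernstein_coeff k j i * Bernstein k i y)"
    by (rule sum.mono_neutral_right) (auto simp: bernstein_coeff_def)
  also have "\<dots> = (\<Sum>l\<le>k - j. bernstein_coeff k j (l + j) * Bernstein k (l + j) y)"
    by (rule sum.reindex_bij_witness[of _ "\<lambda>l. l + j" "\<lambda>i. i - j"]) (use assms in auto)
  also have "\<dots> = (\<Sum>l\<le>k - j. y ^ j * Bernstein (k - j) l y)"
  proof (rule sum.cong[OF refl])
    fix l assume l: "l \<in> {..k - j}"
    then have "(k choose (l + j)) * ((l + j) choose j) = (k choose j) * ((k - j) choose l)"
      using choose_mult[of j "l + j" k] assms by auto
    then have "real (k choose (l + j)) * real ((l + j) choose j)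
        = real (k choose j) * real ((k - j) choose l)"
      by (metis of_nat_mult)
    moreover have "real (k choose j) \<noteq> 0" using assms by simp
    ultimately have "bernstein_coeff k j (l + j) * real (k choose (l + j)) = real ((k - j) choose l)"
      by (simp add: bernstein_coeff_def field_simps)
    moreover have "k - (l + j) = k - j - l" by simp
    ultimately show "bernstein_coeff k j (l + j) * Bernstein k (l + j) y = y ^ j * Bernstein (k - j) l y"
      by (simp add: Bernstein_def power_add mult.assoc[symmetric])
  qed
  also have "\<dots> = y ^ j"
    by (simp add: sum_distrib_left[symmetric])
  finally show ?thesis by simp
qed

lemma bernstein_coeff_bounds:
  assumes "i \<le> k"
  shows "0 \<le> bernstein_coeff k j i" "bernstein_coeff k j i \<le> 1"
proof -
  have "i choose j \<le> k choose j" using assms by (rule binomial_right_mono)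
  then show "bernstein_coeff k j i \<le> 1"
    by (cases "k choose j = 0") (auto simp: bernstein_coeff_def divide_simps)
qed (simp add: bernstein_coeff_def)

lemma bernstein_coeff_Suc:
  assumes "j < k" "i \<le> k"
  shows "bernstein_coeff k (Suc j) i = bernstein_coeff k j i * ((real i - real j) / (real k - real j))"
proof -
  have step: "real (Suc j) * real (n choose Suc j) = (real n - real j) * real (n choose j)" for n
  proof (cases "j \<le> n")
    case True
    have "Suc j * (n choose Suc j) = (n - j) * (n choose j)"
      by (metis Suc_times_binomial_eq binomial_absorb_comp binomial_absorption mult.commute)
    then have "real (Suc j * (n choose Suc j)) = real ((n - j) * (n choose j))" by simp
    then show ?thesis using True by (simp only: of_nat_mult of_nat_diff)
  qed (auto simp: binomial_eq_0)
  have "bernstein_coeff k (Suc j) i = (real (Suc j) * real (i choose Suc j)) / (real (Suc j) * real (k choose Suc j))"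
    by (simp add: bernstein_coeff_def)
  then show ?thesis unfolding step using assms by (simp add: bernstein_coeff_def mult.commute)
qed

text \<open>By \<open>bernstein_coeff_Suc\<close> the coefficient is a product of the \<open>j\<close> ratios \<open>(i - l) / (k - l)\<close>, each of which
differs from \<open>i / k\<close> by at most \<open>l / (k - l)\<close>. The bound is uniform in \<open>i\<close>, and the errors add up because
the partial products stay between 0 and 1.\<close>

lemma bernstein_coeff_approx:
  assumes "e > 0"
  shows "\<exists>k0. \<forall>k\<ge>k0. \<forall>i\<le>k. \<bar>bernstein_coeff k j i - (real i / real k) ^ j\<bar> \<le> e"
  using assms
proof (induction j arbitrary: e)
  case 0
  then show ?case by (simp add: bernstein_coeff_def)
next
  case (Suc j)
  then obtain k0 where k0: "\<And>k i. k \<ge> k0 \<Longrightarrow> i \<le> k \<Longrightarrow> \<bar>bernstein_coeff k j i - (real i / real k) ^ j\<bar> \<le> e / 2"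
    by (metis half_gt_zero)
  obtain k1 :: nat where k1: "real k1 > 2 * real j / e" using reals_Archimedean2 by blast
  have "\<bar>bernstein_coeff k (Suc j) i - (real i / real k) ^ Suc j\<bar> \<le> e"
    if k: "k \<ge> k0 + k1 + j + 1" and i: "i \<le> k" for k i
  proof -
    let ?q = "(real i - real j) / (real k - real j)" and ?t = "real i / real k"
    have pos: "real k - real j > 0" "real k > 0" using k by auto
    have t: "0 \<le> ?t" "?t \<le> 1" using i by (auto simp: divide_simps)
    have "?q - ?t = - (real j * (real k - real i) / (real k * (real k - real j)))"
      using pos by (simp add: field_simps)
    then have "\<bar>?q - ?t\<bar> = real j * (real k - real i) / (real k * (real k - real j))"
      using pos i by (simp add: abs_mult)
    also have "\<dots> \<le> real j * real k / (real k * (real k - real j))"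
      using pos by (intro divide_right_mono mult_left_mono) auto
    also have "\<dots> = real j / (real k - real j)" using pos by simp
    also have "\<dots> \<le> e / 2"
    proof -
      have "2 * real j < e * real k1" using k1 Suc.prems by (simp add: field_simps)
      also have "\<dots> \<le> e * (real k - real j)" using k Suc.prems by (intro mult_left_mono) auto
      finally show ?thesis using pos by (simp add: field_simps)
    qed
    finally have q: "\<bar>?q - ?t\<bar> \<le> e / 2" .
    let ?c = "bernstein_coeff k j i"
    have "\<bar>bernstein_coeff k (Suc j) i - ?t ^ Suc j\<bar> = \<bar>?c * (?q - ?t) + ?t * (?c - ?t ^ j)\<bar>"
      using k i by (subst bernstein_coeff_Suc) (auto simp: algebra_simps)
    also have "\<dots> \<le> \<bar>?c\<bar> * \<bar>?q - ?t\<bar> + \<bar>?t\<bar> * \<bar>?c - ?t ^ j\<bar>"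
      by (metis abs_mult abs_triangle_ineq)
    also have "\<dots> \<le> 1 * (e / 2) + 1 * (e / 2)"
      using q k0[of k i] k i t bernstein_coeff_bounds[OF i, of j]
      by (intro add_mono mult_mono) auto
    finally show ?thesis by simp
  qed
  then show ?case by blast
qed

section \<open>Polynomials that are positive on a box\<close>

text \<open>The Bernstein expansion expresses a positive polynomial by sums and products of nonnegative pieces, so
it certifies membership only in sets closed under both. Membership in a general quadratic module is not
preserved by products, but the quadratic module of a single inequality qualifies.\<close>

definition fun_semiring :: "('a \<Rightarrow> real) set \<Rightarrow> bool" where
  "fun_semiring T \<longleftrightarrow> (\<forall>c\<ge>0. (\<lambda>_. c) \<in> T) \<and>
     (\<forall>f\<in>T. \<forall>g\<in>T. (\<lambda>x. f x + g x) \<in> T \<and> (\<lambda>x. f x * g x) \<in> T)"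

lemma fun_semiring_const: "fun_semiring T \<Longrightarrow> 0 \<le> c \<Longrightarrow> (\<lambda>_. c) \<in> T"
  and fun_semiring_add: "fun_semiring T \<Longrightarrow> f \<in> T \<Longrightarrow> g \<in> T \<Longrightarrow> (\<lambda>x. f x + g x) \<in> T"
  and fun_semiring_mult: "fun_semiring T \<Longrightarrow> f \<in> T \<Longrightarrow> g \<in> T \<Longrightarrow> (\<lambda>x. f x * g x) \<in> T"
  by (auto simp: fun_semiring_def)

lemma fun_semiring_sum:
  assumes "fun_semiring T" "\<And>i. i \<in> I \<Longrightarrow> f i \<in> T"
  shows "(\<lambda>x. \<Sum>i\<in>I. f i x) \<in> T"
  using assms(2)
  by (induction I rule: infinite_finite_induct)
     (auto intro!: fun_semiring_add fun_semiring_const assms(1))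

lemma fun_semiring_prod:
  assumes "fun_semiring T" "\<And>i. i \<in> I \<Longrightarrow> f i \<in> T"
  shows "(\<lambda>x. \<Prod>i\<in>I. f i x) \<in> T"
  using assms(2)
  by (induction I rule: infinite_finite_induct)
     (auto intro!: fun_semiring_mult fun_semiring_const assms(1))

lemma fun_semiring_power:
  assumes "fun_semiring T" "f \<in> T"
  shows "(\<lambda>x. f x ^ n) \<in> T"
  by (induction n) (auto intro!: fun_semiring_mult fun_semiring_const assms)

lemma fun_semiring_Bernstein:
  assumes T: "fun_semiring T" and f: "f \<in> T" "(\<lambda>x. 1 - f x) \<in> T"
  shows "(\<lambda>x. Bernstein k l (f x)) \<in> T"
proof -
  have "(\<lambda>x. (of_nat (k choose l) * f x ^ l) * (1 - f x) ^ (k - l)) \<in> T"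
    by (rule fun_semiring_mult[OF T fun_semiring_mult[OF T fun_semiring_const[OF T]
            fun_semiring_power[OF T f(1)]] fun_semiring_power[OF T f(2)]]) simp
  then show ?thesis by (simp add: Bernstein_def)
qed

definition tensor_bernstein_coeff :: "'k::finite rpoly \<Rightarrow> nat \<Rightarrow> ('k \<Rightarrow> nat) \<Rightarrow> real" where
  "tensor_bernstein_coeff p k \<beta> = (\<Sum>m\<in>Poly_Mapping.keys p. Poly_Mapping.lookup p m *
     (\<Prod>i\<in>UNIV. bernstein_coeff k (Poly_Mapping.lookup m i) (\<beta> i)))"

text \<open>Every one-variable power is expanded in the Bernstein basis; multiplying out the product over the
variables turns the basis into tensor products, indexed by grid points \<open>\<beta>\<close>.\<close>

lemma peval_eq_sum_Bernstein:
  fixes p :: "'k::finite rpoly"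
  assumes "\<And>m i. m \<in> Poly_Mapping.keys p \<Longrightarrow> Poly_Mapping.lookup m i \<le> k"
  shows "peval p y = (\<Sum>\<beta>\<in>(UNIV \<rightarrow>\<^sub>E {..k}).
    tensor_bernstein_coeff p k \<beta> * (\<Prod>i\<in>UNIV. Bernstein k (\<beta> i) (y i)))"
proof -
  have "peval p y = (\<Sum>m\<in>Poly_Mapping.keys p. Poly_Mapping.lookup p m *
     (\<Prod>i\<in>UNIV. \<Sum>l\<le>k. bernstein_coeff k (Poly_Mapping.lookup m i) l * Bernstein k l (y i)))"
    unfolding peval_def
    by (intro sum.cong refl arg_cong2[of _ _ _ _ "(*)"] prod.cong monomial_eq_sum_Bernstein assms)
  also have "\<dots> = (\<Sum>m\<in>Poly_Mapping.keys p. Poly_Mapping.lookup p m * (\<Sum>\<beta>\<in>(UNIV \<rightarrow>\<^sub>E {..k}).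
     (\<Prod>i\<in>UNIV. bernstein_coeff k (Poly_Mapping.lookup m i) (\<beta> i) * Bernstein k (\<beta> i) (y i))))"
    by (subst prod_sum_PiE) auto
  also have "\<dots> = (\<Sum>m\<in>Poly_Mapping.keys p. \<Sum>\<beta>\<in>(UNIV \<rightarrow>\<^sub>E {..k}). Poly_Mapping.lookup p m *
     (\<Prod>i\<in>UNIV. bernstein_coeff k (Poly_Mapping.lookup m i) (\<beta> i)) * (\<Prod>i\<in>UNIV. Bernstein k (\<beta> i) (y i)))"
    by (simp add: sum_distrib_left prod.distrib mult.assoc)
  finally show ?thesis by (subst (asm) sum.swap) (simp add: tensor_bernstein_coeff_def sum_distrib_right)
qed

text \<open>The Bernstein coefficients of \<open>p\<close> converge to the values of \<open>p\<close> on the grid, uniformly in the grid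
point. So they all become nonnegative when \<open>p\<close> is bounded away from 0 on the unit cube.\<close>

lemma bernstein_coeffs_nonneg:
  fixes p :: "'k::finite rpoly"
  assumes "e > 0" and pos: "\<And>y. (\<And>i. 0 \<le> y i \<and> y i \<le> 1) \<Longrightarrow> e \<le> peval p y"
  shows "\<exists>k. (\<forall>m\<in>Poly_Mapping.keys p. \<forall>i. Poly_Mapping.lookup m i \<le> k) \<and>
    (\<forall>\<beta>\<in>(UNIV \<rightarrow>\<^sub>E {..k}). 0 \<le> tensor_bernstein_coeff p k \<beta>)"
proof -
  let ?K = "Poly_Mapping.keys p" and ?n = "real CARD('k)"
  define J where "J = Max (insert 0 (\<Union>m\<in>?K. range (Poly_Mapping.lookup m)))"
  define C where "C = (\<Sum>m\<in>?K. \<bar>Poly_Mapping.lookup p m\<bar>)"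
  define \<eta> where "\<eta> = e / ((C + 1) * ?n)"
  have J: "Poly_Mapping.lookup m i \<le> J" if "m \<in> ?K" for m i
    unfolding J_def by (rule Max_ge) (use that in auto)
  have C: "C \<ge> 0" by (simp add: C_def sum_nonneg)
  have \<eta>: "\<eta> > 0" using C assms(1) by (auto simp: \<eta>_def intro!: divide_pos_pos mult_pos_pos)
  have "\<forall>j. \<exists>k0. \<forall>k\<ge>k0. \<forall>i\<le>k. \<bar>bernstein_coeff k j i - (real i / real k) ^ j\<bar> \<le> \<eta>"
    using bernstein_coeff_approx[OF \<eta>] by blast
  then obtain k0 where k0: "\<And>j k i. k \<ge> k0 j \<Longrightarrow> i \<le> k \<Longrightarrow> \<bar>bernstein_coeff k j i - (real i / real k) ^ j\<bar> \<le> \<eta>"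
    by metis
  define k where "k = max (Max (k0 ` {..J})) J"
  have kJ: "J \<le> k" by (simp add: k_def)
  have kj: "k0 j \<le> k" if "j \<le> J" for j
    using that by (auto simp: k_def intro: max.coboundedI1 Max_ge)
  have "0 \<le> tensor_bernstein_coeff p k \<beta>" if \<beta>: "\<beta> \<in> (UNIV \<rightarrow>\<^sub>E {..k})" for \<beta>
  proof -
    let ?y = "\<lambda>i. real (\<beta> i) / real k"
    have \<beta>k: "\<beta> i \<le> k" for i using \<beta> by (auto simp: PiE_def Pi_def)
    then have y: "0 \<le> ?y i \<and> ?y i \<le> 1" for i by (auto simp: divide_simps)
    \<comment> \<open>The coefficient at \<open>\<beta>\<close> is compared with the value of \<open>p\<close> at the grid point \<open>\<beta> / k\<close>.\<close>
    have prod_close: "\<bar>(\<Prod>i\<in>UNIV. bernstein_coeff k (Poly_Mapping.lookup m i) (\<beta> i)) - (\<Prod>i\<in>UNIV. ?y i ^ Poly_Mapping.lookup m i)\<bar>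
        \<le> ?n * \<eta>" if "m \<in> ?K" for m
    proof -
      have "\<bar>(\<Prod>i\<in>UNIV. bernstein_coeff k (Poly_Mapping.lookup m i) (\<beta> i)) - (\<Prod>i\<in>UNIV. ?y i ^ Poly_Mapping.lookup m i)\<bar>
        \<le> (\<Sum>i\<in>UNIV. \<bar>bernstein_coeff k (Poly_Mapping.lookup m i) (\<beta> i) - ?y i ^ Poly_Mapping.lookup m i\<bar>)"
        unfolding real_norm_def[symmetric]
        by (rule norm_prod_diff)
           (use y bernstein_coeff_bounds[OF \<beta>k] in \<open>auto simp: power_le_one\<close>)
      also have "\<dots> \<le> (\<Sum>i\<in>(UNIV::'k set). \<eta>)"
        by (intro sum_mono k0 kj J that \<beta>k)
      finally show ?thesis by simp
    qed
    have "\<bar>tensor_bernstein_coeff p k \<beta> - peval p ?y\<bar> = \<bar>\<Sum>m\<in>?K. Poly_Mapping.lookup p m *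
        ((\<Prod>i\<in>UNIV. bernstein_coeff k (Poly_Mapping.lookup m i) (\<beta> i)) - (\<Prod>i\<in>UNIV. ?y i ^ Poly_Mapping.lookup m i))\<bar>"
      by (simp add: tensor_bernstein_coeff_def peval_def sum_subtractf right_diff_distrib)
    also have "\<dots> \<le> (\<Sum>m\<in>?K. \<bar>Poly_Mapping.lookup p m\<bar> * (?n * \<eta>))"
      by (rule order_trans[OF sum_abs]) (auto simp: abs_mult intro!: sum_mono mult_left_mono prod_close)
    also have "\<dots> = C * (?n * \<eta>)" by (simp add: C_def sum_distrib_right)
    also have "?n * \<eta> = e / (C + 1)" using C by (simp add: \<eta>_def)
    also have "C * (e / (C + 1)) \<le> e" using C assms(1) by (simp add: field_simps)
    finally show ?thesis using pos[of ?y] y by auto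
  qed
  then show ?thesis using J kJ by (meson order_trans)
qed

text \<open>After rescaling the box to the unit cube, \<open>f\<close> has a Bernstein expansion with nonnegative
coefficients, and each Bernstein polynomial is a product of nonnegative constants and of the affine
functions \<open>c + w $ i\<close> and \<open>c - w $ i\<close>, up to scaling.\<close>

lemma positive_on_box_in_fun_semiring:
  fixes f :: "real^'k \<Rightarrow> real"
  assumes T: "fun_semiring T" and c: "c > 0"
    and lower: "\<And>i. (\<lambda>w. c + w $ i) \<in> T" and upper: "\<And>i. (\<lambda>w. c - w $ i) \<in> T"
    and f: "real_polynomial_function f"
    and pos: "\<And>w. (\<And>i. \<bar>w $ i\<bar> \<le> c) \<Longrightarrow> 0 < f w"
  shows "f \<in> T"
proof -
  define \<phi> where "\<phi> y = (\<chi> i. 2 * c * y $ i - c)" for y :: "real^'k"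
  have "polynomial_function \<phi>"
  proof -
    have "real_polynomial_function (\<lambda>y. 2 * c * y $ i - c)" for i :: 'k
      by (intro real_polynomial_function_diff real_polynomial_function.intros(2-4)
          real_polynomial_function_nth)
    then show ?thesis
      unfolding polynomial_function_iff_Basis_inner
      by (auto simp: Basis_vec_def \<phi>_def inner_axis)
  qed
  then have "real_polynomial_function (f \<circ> \<phi>)"
    using f by (rule real_polynomial_function_compose)
  then obtain p where p: "\<And>y. f (\<phi> y) = peval p (($) y)"
    using real_polynomial_function_imp_peval by (metis comp_apply)
  obtain e where e: "e > 0" "\<And>w. w \<in> cbox (\<chi> i. - c) (\<chi> i. c) \<Longrightarrow> e \<le> f w"
  proof -
    have "(0::real^'k) \<in> cbox (\<chi> i. - c) (\<chi> i. c)"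
      using c by (auto simp: mem_box_cart)
    then have "cbox (\<chi> i. - c) (\<chi> i. c) \<noteq> ({} :: (real^'k) set)" by blast
    moreover have "continuous_on (cbox (\<chi> i. - c) (\<chi> i. c)) f"
      using f by (simp add: continuous_on_polymonial_function real_polynomial_function_eq)
    ultimately obtain w0 where w0: "w0 \<in> cbox (\<chi> i. - c) (\<chi> i. c)"
        "\<And>w. w \<in> cbox (\<chi> i. - c) (\<chi> i. c) \<Longrightarrow> f w0 \<le> f w"
      using continuous_attains_inf[OF compact_cbox] by metis
    have "0 < f w0" using w0(1) by (intro pos) (auto simp: mem_box_cart abs_le_iff minus_le_iff)
    with w0 show ?thesis using that by blast
  qed
  have low: "e \<le> peval p y" if "\<And>i. 0 \<le> y i \<and> y i \<le> 1" for y
  proof -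
    have "\<phi> (\<chi> i. y i) \<in> cbox (\<chi> i. - c) (\<chi> i. c)"
      using that c by (auto simp: mem_box_cart \<phi>_def)
    then have "e \<le> f (\<phi> (\<chi> i. y i))" by (rule e)
    moreover have "($) (\<chi> i. y i) = y" by (rule ext) simp
    ultimately show ?thesis unfolding p by simp
  qed
  have "\<exists>k. (\<forall>m\<in>Poly_Mapping.keys p. \<forall>i. Poly_Mapping.lookup m i \<le> k) \<and>
      (\<forall>\<beta>\<in>(UNIV \<rightarrow>\<^sub>E {..k}). 0 \<le> tensor_bernstein_coeff p k \<beta>)"
    by (rule bernstein_coeffs_nonneg[OF e(1)], rule low) simp
  then obtain k where k': "\<forall>m\<in>Poly_Mapping.keys p. \<forall>i. Poly_Mapping.lookup m i \<le> k"
      "\<forall>\<beta>\<in>(UNIV \<rightarrow>\<^sub>E {..k}). 0 \<le> tensor_bernstein_coeff p k \<beta>"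
    by (elim exE conjE)
  have k: "m \<in> Poly_Mapping.keys p \<Longrightarrow> Poly_Mapping.lookup m i \<le> k"
      "\<beta> \<in> (UNIV \<rightarrow>\<^sub>E {..k}) \<Longrightarrow> 0 \<le> tensor_bernstein_coeff p k \<beta>" for m i \<beta>
    using k' by simp_all
  define u where "u i w = (c + w $ i) * (1 / (2 * c))" for i and w :: "real^'k"
  have u1: "u i \<in> T" for i
    unfolding u_def by (rule fun_semiring_mult[OF T lower fun_semiring_const[OF T]]) (use c in auto)
  have u2: "(\<lambda>w. 1 - u i w) \<in> T" for i
  proof -
    have "(\<lambda>w. (c - w $ i) * (1 / (2 * c))) \<in> T"
      by (rule fun_semiring_mult[OF T upper fun_semiring_const[OF T]]) (use c in auto)
    moreover have "(\<lambda>w. (c - w $ i) * (1 / (2 * c))) = (\<lambda>w. 1 - u i w)"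
      using c by (auto simp: u_def field_simps)
    ultimately show ?thesis by simp
  qed
  have "f w = peval p (\<lambda>i. u i w)" for w
  proof -
    have "\<phi> (\<chi> i. u i w) = w" using c by (simp add: \<phi>_def u_def vec_eq_iff)
    moreover have "($) (\<chi> i. u i w) = (\<lambda>i. u i w)" by (rule ext) simp
    ultimately show ?thesis using p[of "\<chi> i. u i w"] by simp
  qed
  then have "f = (\<lambda>w. \<Sum>\<beta>\<in>(UNIV \<rightarrow>\<^sub>E {..k}).
    tensor_bernstein_coeff p k \<beta> * (\<Prod>i\<in>UNIV. Bernstein k (\<beta> i) (u i w)))"
    using peval_eq_sum_Bernstein[of p k, OF k(1)] by presburger
  also have "\<dots> \<in> T"
    by (intro fun_semiring_sum[OF T] fun_semiring_mult[OF T] fun_semiring_const[OF T]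
        fun_semiring_prod[OF T] fun_semiring_Bernstein[OF T] u1 u2 k(2))
  finally show ?thesis .
qed

section \<open>Sums of squares and quadratic modules\<close>

inductive_set sos_functions :: "('a::real_normed_vector \<Rightarrow> real) set" where
  zero: "(\<lambda>_. 0) \<in> sos_functions"
| add_square: "real_polynomial_function q \<Longrightarrow> s \<in> sos_functions \<Longrightarrow> (\<lambda>x. (q x)\<^sup>2 + s x) \<in> sos_functions"

lemma sos_square: "real_polynomial_function q \<Longrightarrow> (\<lambda>x. (q x)\<^sup>2) \<in> sos_functions"
  using sos_functions.add_square[OF _ sos_functions.zero] by fastforce

lemma sos_add:
  assumes "s \<in> sos_functions" "t \<in> sos_functions"
  shows "(\<lambda>x. s x + t x) \<in> sos_functions"
  using assms(1)
proof induction
  case (add_square q s)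
  then show ?case using sos_functions.add_square[of q "\<lambda>x. s x + t x"] by (simp add: add.assoc)
qed (use assms(2) in simp)

lemma sos_mult_square:
  assumes "s \<in> sos_functions" "real_polynomial_function p"
  shows "(\<lambda>x. (p x)\<^sup>2 * s x) \<in> sos_functions"
  using assms(1)
proof induction
  case zero
  show ?case using sos_functions.zero by simp
next
  case (add_square q s)
  then have "(\<lambda>x. (p x * q x)\<^sup>2 + (p x)\<^sup>2 * s x) \<in> sos_functions"
    by (intro sos_functions.add_square real_polynomial_function.intros(4) assms)
  then show ?case by (simp add: power_mult_distrib distrib_left)
qed

lemma sos_mult:
  assumes "s \<in> sos_functions" "t \<in> sos_functions"
  shows "(\<lambda>x. s x * t x) \<in> sos_functions"
  using assms(1)
proof induction
  case zero
  show ?case using sos_functions.zero by simp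
next
  case (add_square q s)
  then have "(\<lambda>x. (q x)\<^sup>2 * t x + s x * t x) \<in> sos_functions"
    by (intro sos_add sos_mult_square assms)
  then show ?case by (simp add: distrib_right)
qed

lemma sos_const: "0 \<le> c \<Longrightarrow> (\<lambda>_. c) \<in> sos_functions"
  using sos_square[OF real_polynomial_function.intros(2), of "sqrt c"] by simp

lemma sos_sum:
  assumes "\<And>i. i \<in> I \<Longrightarrow> s i \<in> sos_functions"
  shows "(\<lambda>x. \<Sum>i\<in>I. s i x) \<in> sos_functions"
  using assms
proof (induction I rule: infinite_finite_induct)
  case (insert i I)
  have "(\<lambda>x. s i x + (\<Sum>i\<in>I. s i x)) \<in> sos_functions"
    by (rule sos_add) (use insert in simp_all)
  then show ?case using insert.hyps by simp
qed (simp_all add: sos_functions.zero)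

definition quadratic_module :: "('a::real_normed_vector \<Rightarrow> real) set \<Rightarrow> bool" where
  "quadratic_module M \<longleftrightarrow> (\<lambda>_. 1) \<in> M \<and>
     (\<forall>f\<in>M. \<forall>g\<in>M. (\<lambda>x. f x + g x) \<in> M) \<and>
     (\<forall>f\<in>M. \<forall>q. real_polynomial_function q \<longrightarrow> (\<lambda>x. (q x)\<^sup>2 * f x) \<in> M)"

lemma quadratic_module_add:
  "quadratic_module M \<Longrightarrow> f \<in> M \<Longrightarrow> g \<in> M \<Longrightarrow> (\<lambda>x. f x + g x) \<in> M"
  and quadratic_module_square_mult:
  "quadratic_module M \<Longrightarrow> f \<in> M \<Longrightarrow> real_polynomial_function q \<Longrightarrow> (\<lambda>x. (q x)\<^sup>2 * f x) \<in> M"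
  by (simp_all add: quadratic_module_def)

lemma quadratic_module_sos_mult:
  assumes M: "quadratic_module M" and "s \<in> sos_functions" "f \<in> M"
  shows "(\<lambda>x. s x * f x) \<in> M"
  using assms(2)
proof induction
  case zero
  have "(\<lambda>x. 0\<^sup>2 * f x) \<in> M"
    by (rule quadratic_module_square_mult[OF M \<open>f \<in> M\<close> real_polynomial_function.intros(2)])
  then show ?case by simp
next
  case (add_square q s)
  then have "(\<lambda>x. (q x)\<^sup>2 * f x + s x * f x) \<in> M"
    by (intro quadratic_module_add[OF M quadratic_module_square_mult[OF M \<open>f \<in> M\<close>]])
  then show ?case by (simp add: distrib_right)
qed

lemma quadratic_module_sos: "quadratic_module M \<Longrightarrow> s \<in> sos_functions \<Longrightarrow> s \<in> M"
  using quadratic_module_sos_mult[of M s "\<lambda>_. 1"] by (simp add: quadratic_module_def)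

lemma quadratic_module_sum:
  assumes "quadratic_module M" "\<And>i. i \<in> I \<Longrightarrow> f i \<in> M"
  shows "(\<lambda>x. \<Sum>i\<in>I. f i x) \<in> M"
  using assms(2)
proof (induction I rule: infinite_finite_induct)
  case (insert i I)
  have "(\<lambda>x. f i x + (\<Sum>i\<in>I. f i x)) \<in> M"
    by (rule quadratic_module_add[OF assms(1)]) (use insert in simp_all)
  then show ?case using insert.hyps by simp
qed (simp_all add: quadratic_module_sos[OF assms(1)] sos_functions.zero)

text \<open>The quadratic module generated by one function \<open>h\<close>. It is closed under products, because the cross
term \<open>h * h\<close> is a square; this makes it usable where a general quadratic module is not.\<close>

definition principal_module :: "('a::real_normed_vector \<Rightarrow> real) \<Rightarrow> ('a \<Rightarrow> real) set" where
  "principal_module h = {\<lambda>x. s x + t x * h x | s t. s \<in> sos_functions \<and> t \<in> sos_functions}"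

lemma principal_moduleI:
  "s \<in> sos_functions \<Longrightarrow> t \<in> sos_functions \<Longrightarrow> (\<lambda>x. s x + t x * h x) \<in> principal_module h"
  unfolding principal_module_def by (rule CollectI) (rule exI[of _ s], rule exI[of _ t], simp)

lemma fun_semiring_principal_module:
  assumes h: "real_polynomial_function h"
  shows "fun_semiring (principal_module h)"
  unfolding fun_semiring_def
proof (intro conjI ballI allI impI)
  fix c :: real assume "0 \<le> c"
  then show "(\<lambda>_. c) \<in> principal_module h"
    using principal_moduleI[OF sos_const[of c] sos_functions.zero, of h] by simp
next
  fix f g assume "f \<in> principal_module h" "g \<in> principal_module h"
  then obtain s t s' t' where sos: "s \<in> sos_functions" "t \<in> sos_functions" "s' \<in> sos_functions" "t' \<in> sos_functions"
    and f: "f = (\<lambda>x. s x + t x * h x)" and g: "g = (\<lambda>x. s' x + t' x * h x)"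
    by (auto simp: principal_module_def)
  have "(\<lambda>x. f x + g x) = (\<lambda>x. (s x + s' x) + (t x + t' x) * h x)"
    by (auto simp: f g algebra_simps)
  then show "(\<lambda>x. f x + g x) \<in> principal_module h"
    using principal_moduleI[OF sos_add[OF sos(1,3)] sos_add[OF sos(2,4)], of h] by simp
  have fg: "(\<lambda>x. f x * g x) = (\<lambda>x. (s x * s' x + (h x)\<^sup>2 * (t x * t' x)) + (s x * t' x + t x * s' x) * h x)"
    by (auto simp: f g algebra_simps power2_eq_square)
  have "(\<lambda>x. s x * s' x + (h x)\<^sup>2 * (t x * t' x)) \<in> sos_functions"
    by (rule sos_add[OF sos_mult[OF sos(1,3)] sos_mult_square[OF sos_mult[OF sos(2,4)] h]])
  moreover have "(\<lambda>x. s x * t' x + t x * s' x) \<in> sos_functions"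
    by (rule sos_add[OF sos_mult[OF sos(1,4)] sos_mult[OF sos(2,3)]])
  ultimately show "(\<lambda>x. f x * g x) \<in> principal_module h"
    unfolding fg by (rule principal_moduleI)
qed

lemma principal_module_subset:
  assumes "quadratic_module M" "h \<in> M"
  shows "principal_module h \<subseteq> M"
proof
  fix f assume "f \<in> principal_module h"
  then obtain s t where "s \<in> sos_functions" "t \<in> sos_functions" and f: "f = (\<lambda>x. s x + t x * h x)"
    unfolding principal_module_def by blast
  then show "f \<in> M"
    unfolding f by (intro quadratic_module_add[OF assms(1) quadratic_module_sos[OF assms(1)]
          quadratic_module_sos_mult[OF assms(1) _ assms(2)]])
qed

text \<open>With \<open>\<sigma> = \<plusminus>1\<close>, one has \<open>2 * c * (c + \<sigma> * w $ i) = (c + \<sigma> * w $ i)\<^sup>2 + (c\<^sup>2 - (w $ i)\<^sup>2)\<close>, and the last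
difference is \<open>h\<close> plus the squares of the other coordinates plus a nonnegative constant.\<close>

lemma coordinate_bounds_in_principal_module:
  fixes N :: real
  defines "h \<equiv> \<lambda>w::real^'k. N - w \<bullet> w"
  assumes c: "c > 0" "N \<le> c\<^sup>2" and \<sigma>: "\<sigma>\<^sup>2 = 1"
  shows "(\<lambda>w. c + \<sigma> * w $ i) \<in> principal_module h"
proof -
  let ?k = "1 / (2 * c)"
  let ?s = "\<lambda>w::real^'k. ?k * ((c + \<sigma> * w $ i)\<^sup>2 + ((c\<^sup>2 - N) + (\<Sum>j\<in>UNIV - {i}. (w $ j)\<^sup>2)))"
  have k: "(\<lambda>w. ?k) \<in> (sos_functions :: (real^'k \<Rightarrow> real) set)" using c by (intro sos_const) auto
  have "(\<lambda>w. (c + \<sigma> * w $ i)\<^sup>2 + ((c\<^sup>2 - N) + (\<Sum>j\<in>UNIV - {i}. (w $ j)\<^sup>2))) \<in> sos_functions"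
    using c(2) by (intro sos_add[OF sos_square sos_add[OF sos_const sos_sum[OF sos_square]]]
        real_polynomial_function.intros(2-4) real_polynomial_function_nth) auto
  from sos_mult[OF k this] have s: "?s \<in> sos_functions" .
  have "(\<lambda>w. c + \<sigma> * w $ i) = (\<lambda>w. ?s w + ?k * h w)"
  proof
    fix w :: "real^'k"
    have "w \<bullet> w = (\<Sum>j\<in>UNIV. (w $ j)\<^sup>2)" by (simp add: inner_vec_def power2_eq_square)
    also have "\<dots> = (w $ i)\<^sup>2 + (\<Sum>j\<in>UNIV - {i}. (w $ j)\<^sup>2)" by (subst sum.remove[of _ i]) auto
    finally have "?s w + ?k * h w = ?k * ((c + \<sigma> * w $ i)\<^sup>2 + c\<^sup>2 - (w $ i)\<^sup>2)"
      by (simp add: h_def algebra_simps)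
    also have "(c + \<sigma> * w $ i)\<^sup>2 + c\<^sup>2 - (w $ i)\<^sup>2 = 2 * c * (c + \<sigma> * w $ i)"
      using \<sigma> by (simp add: power2_eq_square algebra_simps)
    also have "?k * \<dots> = c + \<sigma> * w $ i" using c by simp
    finally show "c + \<sigma> * w $ i = ?s w + ?k * h w" by simp
  qed
  then show ?thesis using principal_moduleI[OF s k, of h] by simp
qed

lemma positive_on_box_in_principal_module:
  fixes f :: "real^'k \<Rightarrow> real"
  assumes c: "c > 0" "N \<le> c\<^sup>2" and f: "real_polynomial_function f"
    and pos: "\<And>w. (\<And>i. \<bar>w $ i\<bar> \<le> c) \<Longrightarrow> 0 < f w"
  shows "f \<in> principal_module (\<lambda>w. N - w \<bullet> w)"
proof (rule positive_on_box_in_fun_semiring[OF fun_semiring_principal_module c(1) _ _ f pos])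
  show "real_polynomial_function (\<lambda>w::real^'k. N - w \<bullet> w)"
    unfolding inner_vec_def by (auto intro!: real_polynomial_function_diff real_polynomial_function.intros(2-4))
next
  show "(\<lambda>w. c + w $ i) \<in> principal_module (\<lambda>w::real^'k. N - w \<bullet> w)" for i
    using coordinate_bounds_in_principal_module[OF c, of 1 i] by simp
  show "(\<lambda>w. c - w $ i) \<in> principal_module (\<lambda>w::real^'k. N - w \<bullet> w)" for i
    using coordinate_bounds_in_principal_module[OF c, of "-1" i] by simp
qed

section \<open>Putinar's Positivstellensatz\<close>

text \<open>The function \<open>(1 - x) ^ k * x\<close> is uniformly small where the constraint \<open>0 \<le> x \<le> 1\<close> holds, and at most
\<open>x\<close> where it is violated. This makes it a penalty whose subtraction costs little at feasible points.\<close>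

lemma penalty_bound:
  fixes x :: real
  assumes "x \<le> 1"
  shows "(1 - x) ^ k * x \<le> 1 / (real k + 1)"
proof (cases "x \<le> 0")
  case True
  then have "(1 - x) ^ k * x \<le> 0" by (simp add: mult_nonneg_nonpos)
  then show ?thesis by (rule order_trans) simp
next
  case False
  \<comment> \<open>By Bernoulli's inequality, \<open>1 + k * x\<close> is at most \<open>(1 + x) ^ k\<close>, and \<open>(1 + x) * (1 - x) \<le> 1\<close>.\<close>
  have "(1 + real k * x) * (1 - x) ^ k \<le> (1 + x) ^ k * (1 - x) ^ k"
    using False assms Bernoulli_inequality[of x k] by (intro mult_right_mono) auto
  also have "\<dots> = (1 - x\<^sup>2) ^ k" by (simp add: power_mult_distrib[symmetric] power2_eq_square algebra_simps)
  also have "\<dots> \<le> 1" using False assms by (intro power_le_one) (auto simp: power_le_one)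
  finally have *: "(1 + real k * x) * (1 - x) ^ k \<le> 1" .
  have "(real k + 1) * ((1 - x) ^ k * x) = (1 + real k * x) * (1 - x) ^ k - (1 - x) ^ Suc k"
    by (simp add: algebra_simps)
  also have "\<dots> \<le> 1" using * assms by (smt (verit) zero_le_power)
  finally show ?thesis by (simp add: field_simps)
qed

lemma penalty_negative:
  fixes x :: real
  assumes "x \<le> 0"
  shows "(1 - x) ^ k * x \<le> x"
proof -
  have "1 \<le> (1 - x) ^ k" using assms by (intro one_le_power) auto
  then show ?thesis using assms mult_right_mono_neg[of 1 "(1 - x) ^ k" x] by simp
qed

text \<open>Positivity on the feasible part of a compact set is extended to the whole set. Where \<open>f\<close> is not safely
positive some constraint is violated by a fixed amount, so a large weight \<open>l\<close> lifts the difference above 0;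
then \<open>k\<close> is chosen so large that the satisfied constraints spoil at most the margin of \<open>f\<close>.
The even exponent makes the penalty a square times a constraint.\<close>

lemma penalized_positive:
  fixes f :: "'a::topological_space \<Rightarrow> real"
  assumes C: "compact C" and f: "continuous_on C f"
    and G: "finite G" "\<And>g. g \<in> G \<Longrightarrow> continuous_on C g" "\<And>g x. g \<in> G \<Longrightarrow> x \<in> C \<Longrightarrow> g x \<le> 1"
    and pos: "\<And>x. x \<in> C \<Longrightarrow> (\<And>g. g \<in> G \<Longrightarrow> 0 \<le> g x) \<Longrightarrow> 0 < f x"
  shows "\<exists>l\<ge>0. \<exists>k. \<forall>x\<in>C. 0 < f x - l * (\<Sum>g\<in>G. (1 - g x) ^ (2 * k) * g x)"
proof -
  define n where "n = real (card G)"
  define viol where "viol x = (\<Sum>g\<in>G. max 0 (- g x))" for x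
  \<comment> \<open>Everywhere on the compact set either \<open>f\<close> or the total violation is positive, so their
     maximum is bounded away from 0.\<close>
  have viol: "0 \<le> viol x" for x by (simp add: viol_def sum_nonneg)
  have "\<exists>e>0. \<forall>x\<in>C. e \<le> max (f x) (viol x)"
  proof (cases "C = {}")
    case False
    have "continuous_on C (\<lambda>x. max (f x) (viol x))"
      unfolding viol_def by (intro continuous_intros f G)
    from continuous_attains_inf[OF C False this]
    obtain x0 where x0: "x0 \<in> C" "\<And>x. x \<in> C \<Longrightarrow> max (f x0) (viol x0) \<le> max (f x) (viol x)"
      by blast
    have "0 < max (f x0) (viol x0)"
    proof (cases "\<forall>g\<in>G. 0 \<le> g x0")
      case True
      then show ?thesis using pos[OF x0(1)] by auto
    next
      case False
      then obtain g where "g \<in> G" "g x0 < 0" by force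
      then have "0 < viol x0" unfolding viol_def using G(1) by (intro sum_pos2[of G g]) auto
      then show ?thesis by auto
    qed
    then show ?thesis using x0(2) by blast
  qed (auto intro: exI[of _ 1])
  then obtain e where e: "e > 0" "\<And>x. x \<in> C \<Longrightarrow> e \<le> max (f x) (viol x)" by blast
  obtain Mf where Mf: "Mf \<ge> 0" "\<And>x. x \<in> C \<Longrightarrow> - Mf \<le> f x"
  proof -
    have "bounded (f ` C)" by (intro compact_imp_bounded compact_continuous_image f C)
    then obtain b where b: "\<And>x. x \<in> C \<Longrightarrow> \<bar>f x\<bar> \<le> b" by (auto simp: bounded_iff)
    show ?thesis by (rule that[of "\<bar>b\<bar>"]) (use b in \<open>force+\<close>)
  qed
  \<comment> \<open>This weight turns a violation of size \<open>e\<close> into a gain of \<open>Mf + e\<close>.\<close>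
  define l where "l = (Mf + e) / e"
  have l: "0 \<le> l" using Mf e by (simp add: l_def)
  obtain k :: nat where k: "real k > l * n / e" using reals_Archimedean2 by blast
  have small: "l * (n / (real (2 * k) + 1)) < e"
  proof -
    have "l * n < e * real k" using k e by (simp add: field_simps)
    also have "\<dots> \<le> e * (real (2 * k) + 1)" using e by simp
    finally show ?thesis using e by (simp add: field_simps)
  qed
  have "0 < f x - l * (\<Sum>g\<in>G. (1 - g x) ^ (2 * k) * g x)" if x: "x \<in> C" for x
  proof -
    have "(1 - g x) ^ (2 * k) * g x \<le> 1 / (real (2 * k) + 1) - max 0 (- g x)" if "g \<in> G" for g
    proof (cases "g x \<le> 0")
      case True
      moreover have "0 \<le> 1 / (real (2 * k) + 1)" by simp
      ultimately show ?thesis using penalty_negative[of "g x" "2 * k"] by linarith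
    next
      case False
      then show ?thesis using penalty_bound[OF G(3)[OF that x], of "2 * k"] by simp
    qed
    then have "(\<Sum>g\<in>G. (1 - g x) ^ (2 * k) * g x) \<le> (\<Sum>g\<in>G. 1 / (real (2 * k) + 1) - max 0 (- g x))"
      by (rule sum_mono)
    also have "\<dots> = n / (real (2 * k) + 1) - viol x" by (simp add: sum_subtractf viol_def n_def)
    finally have "l * (\<Sum>g\<in>G. (1 - g x) ^ (2 * k) * g x) \<le> l * (n / (real (2 * k) + 1) - viol x)"
      using l by (rule mult_left_mono)
    then have "l * (\<Sum>g\<in>G. (1 - g x) ^ (2 * k) * g x) \<le> l * (n / (real (2 * k) + 1)) - l * viol x"
      by (simp only: right_diff_distrib)
    then have *: "l * (\<Sum>g\<in>G. (1 - g x) ^ (2 * k) * g x) < e - l * viol x" using small by linarith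
    show ?thesis
    proof (cases "e \<le> f x")
      case True
      then show ?thesis using * mult_nonneg_nonneg[OF l viol[of x]] by linarith
    next
      case False
      then have "e \<le> viol x" using e(2)[OF x] by auto
      then have "l * e \<le> l * viol x" using l by (rule mult_left_mono)
      moreover have "l * e = Mf + e" using e by (simp add: l_def)
      ultimately show ?thesis using * Mf(2)[OF x] by linarith
    qed
  qed
  then show ?thesis using l by blast
qed

text \<open>Putinar's Positivstellensatz. The penalty of \<open>penalized_positive\<close> lies in \<open>M\<close>, and \<open>f\<close> minus the
penalty is positive on an entire box, hence lies in the module of the single function \<open>N - w \<bullet> w\<close>.\<close>

theorem putinar:
  fixes f :: "real^'k \<Rightarrow> real"
  assumes M: "quadratic_module M" and ball: "(\<lambda>w. N - w \<bullet> w) \<in> M"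
    and G: "finite G" "G \<subseteq> M" "\<And>g. g \<in> G \<Longrightarrow> real_polynomial_function g"
    and f: "real_polynomial_function f"
    and pos: "\<And>w. (\<And>g. g \<in> G \<Longrightarrow> 0 \<le> g w) \<Longrightarrow> w \<bullet> w \<le> N \<Longrightarrow> 0 < f w"
  shows "f \<in> M"
proof -
  define h where "h w = N - w \<bullet> w" for w :: "real^'k"
  define H where "H = insert h G"
  have H: "finite H" "H \<subseteq> M" "\<And>g. g \<in> H \<Longrightarrow> real_polynomial_function g"
  proof -
    have "real_polynomial_function h"
      unfolding h_def inner_vec_def
      by (auto intro!: real_polynomial_function_diff real_polynomial_function.intros(2-4))
    then show "\<And>g. g \<in> H \<Longrightarrow> real_polynomial_function g" using G(3) by (auto simp: H_def)
    have "h = (\<lambda>w. N - w \<bullet> w)" by (auto simp: h_def)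
    then show "H \<subseteq> M" using G(2) ball by (auto simp: H_def)
  qed (use G in \<open>auto simp: H_def\<close>)
  \<comment> \<open>With \<open>N \<le> c\<^sup>2\<close> the bounds \<open>c \<plusminus> w $ i\<close> lie in the module of the ball constraint.\<close>
  define c where "c = \<bar>N\<bar> + 1"
  have c: "c > 0" "N \<le> c\<^sup>2"
  proof -
    show "c > 0" by (simp add: c_def)
    have "c \<le> c\<^sup>2" using self_le_power[of c 2] by (simp add: c_def)
    then show "N \<le> c\<^sup>2" by (simp add: c_def)
  qed
  define C :: "(real^'k) set" where "C = cbox (\<chi> i. - c) (\<chi> i. c)"
  have C: "compact C" "w \<in> C \<longleftrightarrow> (\<forall>i. \<bar>w $ i\<bar> \<le> c)" for w
    by (auto simp: C_def mem_box_cart abs_le_iff minus_le_iff)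
  have cont: "continuous_on C g" if "real_polynomial_function g" for g
    using that by (simp add: continuous_on_polymonial_function real_polynomial_function_eq)
  have "\<forall>g\<in>H. \<exists>b>0. \<forall>x\<in>C. g x \<le> b"
  proof
    fix g assume "g \<in> H"
    then have "bounded (g ` C)" by (intro compact_imp_bounded compact_continuous_image cont H C)
    then obtain b where "\<And>x. x \<in> C \<Longrightarrow> \<bar>g x\<bar> \<le> b" by (auto simp: bounded_iff)
    then show "\<exists>b>0. \<forall>x\<in>C. g x \<le> b" by (intro exI[of _ "\<bar>b\<bar> + 1"]) force
  qed
  then obtain \<beta> where \<beta>: "\<And>g. g \<in> H \<Longrightarrow> \<beta> g > 0" "\<And>g x. g \<in> H \<Longrightarrow> x \<in> C \<Longrightarrow> g x \<le> \<beta> g"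
    by metis
  \<comment> \<open>The penalty estimates need the constraints to be at most 1 on the box.\<close>
  define scl where "scl g = (\<lambda>x. (1 / \<beta> g) * g x)" for g :: "real^'k \<Rightarrow> real"
  have scl: "scl g \<in> M" "real_polynomial_function (scl g)" if "g \<in> H" for g
  proof -
    show "scl g \<in> M" unfolding scl_def using \<beta>(1)[OF that] H(2) that
      by (intro quadratic_module_sos_mult[OF M sos_const]) auto
    show "real_polynomial_function (scl g)"
      unfolding scl_def by (intro real_polynomial_function.intros H that)
  qed
  have "\<exists>l\<ge>0. \<exists>k. \<forall>x\<in>C. 0 < f x - l * (\<Sum>g\<in>scl ` H. (1 - g x) ^ (2 * k) * g x)"
  proof (rule penalized_positive[OF C(1) cont[OF f]])
    show "g x \<le> 1" if "g \<in> scl ` H" "x \<in> C" for g x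
      using that \<beta> by (auto simp: scl_def)
    show "0 < f x" if "x \<in> C" and nonneg: "\<And>g. g \<in> scl ` H \<Longrightarrow> 0 \<le> g x" for x
    proof -
      have H_nonneg: "0 \<le> g x" if "g \<in> H" for g
        using nonneg[of "scl g"] \<beta>(1)[OF that] that by (auto simp: scl_def zero_le_divide_iff)
      have "x \<bullet> x \<le> N" using H_nonneg[of h] by (simp add: H_def h_def)
      then show ?thesis using H_nonneg by (intro pos) (auto simp: H_def)
    qed
  qed (use H scl cont in auto)
  then obtain l k where l: "l \<ge> 0"
    and lk: "\<And>x. x \<in> C \<Longrightarrow> 0 < f x - l * (\<Sum>g\<in>scl ` H. (1 - g x) ^ (2 * k) * g x)" by blast
  define pen where "pen x = l * (\<Sum>g\<in>scl ` H. ((1 - g x) ^ k)\<^sup>2 * g x)" for x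
  have pen: "pen \<in> M"
    unfolding pen_def
  proof (intro quadratic_module_sos_mult[OF M sos_const[OF l]] quadratic_module_sum[OF M])
    fix g assume "g \<in> scl ` H"
    then have "g \<in> M" "real_polynomial_function (\<lambda>x. (1 - g x) ^ k)"
      using scl by (auto intro!: real_polynomial_function_power real_polynomial_function_diff
          real_polynomial_function.intros(2))
    then show "(\<lambda>x. ((1 - g x) ^ k)\<^sup>2 * g x) \<in> M"
      by (rule quadratic_module_square_mult[OF M])
  qed
  have "real_polynomial_function (\<lambda>x. f x - pen x)"
    unfolding pen_def
    by (intro real_polynomial_function_diff f real_polynomial_function.intros(2,4)
        real_polynomial_function_sum real_polynomial_function_power) (use H scl in auto)
  moreover have "0 < f w - pen w" if "\<And>i. \<bar>w $ i\<bar> \<le> c" for w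
    using lk[of w] that C(2) by (simp add: pen_def power_even_eq)
  ultimately have "(\<lambda>x. f x - pen x) \<in> principal_module (\<lambda>w. N - w \<bullet> w)"
    by (intro positive_on_box_in_principal_module[OF c]) auto
  then have "(\<lambda>x. f x - pen x) \<in> M" using principal_module_subset[OF M ball] by blast
  from quadratic_module_add[OF M this pen] show ?thesis by simp
qed

text \<open>The quadratic module generated by inequalities \<open>0 \<le> g i\<close> for \<open>i \<in> I\<close> together with an equation
\<open>e = 0\<close>, whose multiplier \<open>r\<close> is arbitrary. Plain sums of squares are covered by taking the constant 1
as one of the \<open>g i\<close>, like \<open>a 0\<close> in the programs. The constraint of the semidefinite programs is membership
in such a set, apart from degrees.\<close>

definition certificates :: "('a::real_normed_vector \<Rightarrow> real) \<Rightarrow> 'i set \<Rightarrow> ('i \<Rightarrow> 'a \<Rightarrow> real) \<Rightarrow> ('a \<Rightarrow> real) set" where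
  "certificates e I g = {F. \<exists>r s. real_polynomial_function r \<and> (\<forall>i\<in>I. s i \<in> sos_functions) \<and>
     F = (\<lambda>w. r w * e w + (\<Sum>i\<in>I. s i w * g i w))}"

lemma certificatesI:
  assumes "real_polynomial_function r" "\<And>i. i \<in> I \<Longrightarrow> s i \<in> sos_functions"
  shows "(\<lambda>w. r w * e w + (\<Sum>i\<in>I. s i w * g i w)) \<in> certificates e I g"
  unfolding certificates_def using assms by (intro CollectI exI[of _ r] exI[of _ s]) simp

lemma certificates_equation:
  assumes "real_polynomial_function r"
  shows "(\<lambda>w. r w * e w) \<in> certificates e I g"
  using certificatesI[OF assms, of I "\<lambda>_ _. 0" e g] by (simp add: sos_functions.zero)

lemma certificates_inequality:
  assumes "finite I" "i \<in> I"
  shows "g i \<in> certificates e I g"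
proof -
  let ?s = "\<lambda>j w. if j = i then 1 else 0"
  have "?s j \<in> sos_functions" for j
    by (simp add: sos_const sos_functions.zero)
  then have "(\<lambda>w. 0 * e w + (\<Sum>j\<in>I. ?s j w * g j w)) \<in> certificates e I g"
    by (intro certificatesI real_polynomial_function.intros(2))
  moreover have "(\<lambda>w. 0 * e w + (\<Sum>j\<in>I. ?s j w * g j w)) = g i"
  proof
    fix w
    have "(\<Sum>j\<in>I. ?s j w * g j w) = (\<Sum>j\<in>I. if j = i then g j w else 0)" by (intro sum.cong) simp_all
    then show "0 * e w + (\<Sum>j\<in>I. ?s j w * g j w) = g i w" using assms by simp
  qed
  ultimately show ?thesis by simp
qed

lemma certificates_quadratic_module:
  fixes e :: "'a::real_normed_vector \<Rightarrow> real"
  assumes "finite I" "i \<in> I" "\<And>w. g i w = 1"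
  shows "quadratic_module (certificates e I g)"
  unfolding quadratic_module_def
proof (intro conjI ballI allI impI)
  have "g i = (\<lambda>_. 1)" by (rule ext) (rule assms(3))
  then show "(\<lambda>_. 1) \<in> certificates e I g"
    using certificates_inequality[OF assms(1,2), where g = g and e = e] by (simp only:)
next
  fix F G assume "F \<in> certificates e I g" "G \<in> certificates e I g"
  then obtain r s r' s' where r: "real_polynomial_function r" "real_polynomial_function r'"
    and s: "\<And>i. i \<in> I \<Longrightarrow> s i \<in> sos_functions" "\<And>i. i \<in> I \<Longrightarrow> s' i \<in> sos_functions"
    and FG: "F = (\<lambda>w. r w * e w + (\<Sum>i\<in>I. s i w * g i w))" "G = (\<lambda>w. r' w * e w + (\<Sum>i\<in>I. s' i w * g i w))"
    unfolding certificates_def by blast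
  have "(\<lambda>x. F x + G x) = (\<lambda>w. (r w + r' w) * e w + (\<Sum>i\<in>I. (s i w + s' i w) * g i w))"
    by (rule ext) (simp add: FG distrib_right sum.distrib)
  then show "(\<lambda>x. F x + G x) \<in> certificates e I g"
    using certificatesI[where r = "\<lambda>w. r w + r' w" and s = "\<lambda>i w. s i w + s' i w" and I = I and e = e and g = g,
        OF real_polynomial_function.intros(3)[OF r] sos_add[OF s]] by simp
next
  fix F and q :: "'a \<Rightarrow> real" assume q: "real_polynomial_function q" and "F \<in> certificates e I g"
  then obtain r s where r: "real_polynomial_function r"
    and s: "\<And>i. i \<in> I \<Longrightarrow> s i \<in> sos_functions"
    and F: "F = (\<lambda>w. r w * e w + (\<Sum>i\<in>I. s i w * g i w))"
    unfolding certificates_def by blast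
  have "(\<lambda>x. (q x)\<^sup>2 * F x) = (\<lambda>w. ((q w)\<^sup>2 * r w) * e w + (\<Sum>i\<in>I. ((q w)\<^sup>2 * s i w) * g i w))"
    by (rule ext) (simp add: F distrib_left sum_distrib_left mult.assoc)
  moreover have "real_polynomial_function (\<lambda>w. (q w)\<^sup>2 * r w)"
    by (intro real_polynomial_function.intros(4) real_polynomial_function_power q r)
  ultimately show "(\<lambda>x. (q x)\<^sup>2 * F x) \<in> certificates e I g"
    using certificatesI[where r = "\<lambda>w. (q w)\<^sup>2 * r w" and s = "\<lambda>i w. (q w)\<^sup>2 * s i w" and I = I and e = e and g = g,
        OF _ sos_mult_square[OF s q]] by simp
qed

text \<open>The equation \<open>e = 0\<close> is treated as the pair of inequalities \<open>0 \<le> e\<close> and \<open>0 \<le> - e\<close>.\<close>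

theorem putinar_certificate:
  fixes f e :: "real^'k \<Rightarrow> real"
  assumes I: "finite I" "i0 \<in> I" "\<And>w. g i0 w = 1"
    and poly: "\<And>i. i \<in> I \<Longrightarrow> real_polynomial_function (g i)" "real_polynomial_function e"
      "real_polynomial_function f"
    and ball: "(\<lambda>w. N - w \<bullet> w) \<in> certificates e I g"
    and pos: "\<And>w. e w = 0 \<Longrightarrow> (\<And>i. i \<in> I \<Longrightarrow> 0 \<le> g i w) \<Longrightarrow> 0 < f w"
  shows "f \<in> certificates e I g"
proof (rule putinar[OF certificates_quadratic_module[where g = g, OF I] ball])
  let ?G = "insert (\<lambda>w. 1 * e w) (insert (\<lambda>w. (-1) * e w) (g ` I))"
  show "finite ?G" using I(1) by simp
  have "(\<lambda>w. c * e w) \<in> certificates e I g" for c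
    by (rule certificates_equation[OF real_polynomial_function.intros(2)])
  then show "?G \<subseteq> certificates e I g"
    using certificates_inequality[OF I(1)] by blast
  have "real_polynomial_function (\<lambda>w. c * e w)" for c
    by (rule real_polynomial_function.intros(4)[OF real_polynomial_function.intros(2) poly(2)])
  then show "real_polynomial_function h" if "h \<in> ?G" for h
    using that poly(1) by blast
  show "real_polynomial_function f" by (rule poly(3))
  fix w :: "real^'k" assume nonneg: "\<And>h. h \<in> ?G \<Longrightarrow> 0 \<le> h w"
  have "e w = 0" using nonneg[of "\<lambda>w. 1 * e w"] nonneg[of "\<lambda>w. (-1) * e w"] by simp
  then show "0 < f w" by (rule pos) (auto intro: nonneg)
qed

lemma sos_functions_imp_peval:
  fixes s :: "real^'k \<Rightarrow> real"
  assumes "s \<in> sos_functions"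
  shows "\<exists>qs. \<forall>w. s w = peval (\<Sum>q\<leftarrow>qs. q\<^sup>2) (($) w)"
  using assms
proof induction
  case zero
  show ?case by (rule exI[of _ "[]"]) simp
next
  case (add_square q s)
  obtain p where p: "\<forall>w. q w = peval p (($) w)"
    using real_polynomial_function_imp_peval[OF add_square.hyps(1)] by blast
  obtain qs where qs: "\<forall>w. s w = peval (\<Sum>q\<leftarrow>qs. q\<^sup>2) (($) w)" using add_square.IH by blast
  show ?case by (rule exI[of _ "p # qs"]) (simp add: p qs peval_add peval_power2)
qed

lemma peval_sos_nonneg: "0 \<le> peval (\<Sum>q\<leftarrow>qs. q\<^sup>2) z"
  by (induction qs) (simp_all add: peval_add peval_power2)

section \<open>Modes of convergence\<close>

lemma set_integrable_continuous_compact: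
  fixes f :: "'a::euclidean_space \<Rightarrow> real"
  assumes "compact S" "continuous_on S f"
  shows "set_integrable lebesgue S f"
proof -
  have int: "integrable lborel (\<lambda>x. indicator S x *\<^sub>R f x)"
    using assms by (rule borel_integrable_compact)
  then show ?thesis
    unfolding set_integrable_def
    by (subst integrable_completion) (rule borel_measurable_integrable)
qed

lemma set_integral_mono_continuous:
  fixes f g :: "'a::euclidean_space \<Rightarrow> real"
  assumes "compact S" "continuous_on S f" "continuous_on S g" "\<And>x. x \<in> S \<Longrightarrow> f x \<le> g x"
  shows "(LINT x:S|lebesgue. f x) \<le> (LINT x:S|lebesgue. g x)"
  using assms by (intro set_integral_mono set_integrable_continuous_compact)

lemma lmeasurable_superlevel:
  fixes f :: "'a::euclidean_space \<Rightarrow> real"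
  assumes "compact S" "continuous_on S f"
  shows "{x\<in>S. e \<le> f x} \<in> lmeasurable"
proof (rule lmeasurable_compact)
  have "{x\<in>S. e \<le> f x} = S \<inter> {x\<in>S. e \<le> f x}" by auto
  moreover have "closed {x\<in>S. e \<le> f x}"
    using assms by (intro continuous_on_closed_Collect_le continuous_intros compact_imp_closed)
  ultimately show "compact {x\<in>S. e \<le> f x}" using assms(1) by (metis compact_Int_closed)
qed

lemma markov_inequality_on:
  fixes f :: "'a::euclidean_space \<Rightarrow> real"
  assumes S: "compact S" "continuous_on S f" and "e > 0"
  shows "measure lebesgue {x\<in>S. e \<le> \<bar>f x\<bar>} \<le> (LINT x:S|lebesgue. \<bar>f x\<bar>) / e"
proof -
  have cont: "continuous_on S (\<lambda>x. \<bar>f x\<bar>)" by (intro continuous_intros S)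
  have int: "integrable lebesgue (\<lambda>x. indicator S x *\<^sub>R \<bar>f x\<bar>)"
    using set_integrable_continuous_compact[OF S(1) cont] by (simp add: set_integrable_def)
  have "measure lebesgue {x\<in>space lebesgue. e \<le> indicator S x *\<^sub>R \<bar>f x\<bar>}
      \<le> (LINT x|lebesgue. indicator S x *\<^sub>R \<bar>f x\<bar>) / e"
    by (rule integral_Markov_inequality_measure[OF int sets.empty_sets _ \<open>e > 0\<close>]) simp
  moreover have "{x\<in>space lebesgue. e \<le> indicator S x *\<^sub>R \<bar>f x\<bar>} = {x\<in>S. e \<le> \<bar>f x\<bar>}"
    using \<open>e > 0\<close> by (auto simp: indicator_def split: if_splits)
  ultimately show ?thesis by (simp add: set_lebesgue_integral_def)
qed

lemma converges_L1_imp_in_measure: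
  fixes f :: "nat \<Rightarrow> 'a::euclidean_space \<Rightarrow> real"
  assumes S: "compact S" and l: "continuous_on S l" and f: "\<And>d. continuous_on S (f d)"
    and L1: "converges_L1_on S f l"
  shows "converges_in_measure_on S f l"
  unfolding converges_in_measure_on_def
proof (intro allI impI conjI)
  fix e :: real assume e: "e > 0"
  have cont: "continuous_on S (\<lambda>x. l x - f d x)" for d by (intro continuous_intros l f)
  have "{x\<in>S. e \<le> \<bar>l x - f d x\<bar>} \<in> lmeasurable" for d
    by (intro lmeasurable_superlevel S continuous_intros l f)
  then show "\<forall>\<^sub>F d in sequentially. {x\<in>S. e \<le> \<bar>l x - f d x\<bar>} \<in> lmeasurable" by simp
  have lim: "(\<lambda>d. (LINT x:S|lebesgue. \<bar>l x - f d x\<bar>) / e) \<longlonglongrightarrow> 0"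
    using L1 tendsto_divide[of _ 0 sequentially "\<lambda>_. e" e] e by (simp add: converges_L1_on_def)
  show "(\<lambda>d. measure lebesgue {x\<in>S. e \<le> \<bar>l x - f d x\<bar>}) \<longlonglongrightarrow> 0"
    by (rule tendsto_sandwich[OF _ _ tendsto_const lim])
       (auto intro!: always_eventually markov_inequality_on[OF S cont e])
qed

lemma converges_in_measure_mono:
  fixes f h :: "nat \<Rightarrow> 'a::euclidean_space \<Rightarrow> real"
  assumes f: "converges_in_measure_on S f l"
    and le: "\<And>d x. d \<ge> d0 \<Longrightarrow> x \<in> S \<Longrightarrow> \<bar>l x - h d x\<bar> \<le> \<bar>l x - f d x\<bar>"
    and meas: "\<And>d e. d \<ge> d0 \<Longrightarrow> {x\<in>S. e \<le> \<bar>l x - h d x\<bar>} \<in> lmeasurable"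
  shows "converges_in_measure_on S h l"
  unfolding converges_in_measure_on_def
proof (intro allI impI conjI)
  fix e :: real assume e: "e > 0"
  show "\<forall>\<^sub>F d in sequentially. {x\<in>S. e \<le> \<bar>l x - h d x\<bar>} \<in> lmeasurable"
    using meas eventually_sequentially by blast
  have lim: "(\<lambda>d. measure lebesgue {x\<in>S. e \<le> \<bar>l x - f d x\<bar>}) \<longlonglongrightarrow> 0"
    and fm: "\<forall>\<^sub>F d in sequentially. {x\<in>S. e \<le> \<bar>l x - f d x\<bar>} \<in> lmeasurable"
    using f e by (auto simp: converges_in_measure_on_def)
  have "\<forall>\<^sub>F d in sequentially. measure lebesgue {x\<in>S. e \<le> \<bar>l x - h d x\<bar>}
      \<le> measure lebesgue {x\<in>S. e \<le> \<bar>l x - f d x\<bar>}"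
    using fm eventually_ge_at_top[of d0]
  proof eventually_elim
    case (elim d)
    have "{x\<in>S. e \<le> \<bar>l x - h d x\<bar>} \<subseteq> {x\<in>S. e \<le> \<bar>l x - f d x\<bar>}"
      using le[OF elim(2)] by force
    then show ?case
      by (rule measure_mono_fmeasurable[OF _ fmeasurableD[OF meas[OF elim(2)]] elim(1)])
  qed
  then show "(\<lambda>d. measure lebesgue {x\<in>S. e \<le> \<bar>l x - h d x\<bar>}) \<longlonglongrightarrow> 0"
    by (intro tendsto_sandwich[OF _ _ tendsto_const lim]) auto
qed

text \<open>A direct form of Egorov's theorem: by monotonicity, a bound \<open>1 / Suc k\<close> on the error at one index
\<open>D k\<close> persists at all later indices, so it suffices to remove one small exceptional set for each \<open>k\<close>,
with geometrically decreasing measures.\<close>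

lemma monotone_in_measure_imp_almost_uniformly:
  fixes f :: "nat \<Rightarrow> 'a::euclidean_space \<Rightarrow> real"
  assumes mono: "nondecreasing_from_on d0 S f"
    and le: "\<And>d x. d \<ge> d0 \<Longrightarrow> x \<in> S \<Longrightarrow> f d x \<le> l x"
    and conv: "converges_in_measure_on S f l"
  shows "converges_almost_uniformly_on S f l"
  unfolding converges_almost_uniformly_on_def
proof (intro allI impI)
  fix e :: real assume e: "e > 0"
  define X where "X k d = {x\<in>S. 1 / real (Suc k) \<le> \<bar>l x - f d x\<bar>}" for k d
  have "\<exists>d\<ge>d0. X k d \<in> lmeasurable \<and> measure lebesgue (X k d) < e / 2 * (1/2) ^ Suc k" for k
  proof -
    have "0 < e / 2 * (1/2) ^ Suc k" "0 < 1 / real (Suc k)" using e by simp_all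
    then have "\<forall>\<^sub>F d in sequentially. X k d \<in> lmeasurable"
      "\<forall>\<^sub>F d in sequentially. measure lebesgue (X k d) < e / 2 * (1/2) ^ Suc k"
      using conv order_tendstoD(2)[of _ 0 sequentially "e / 2 * (1/2) ^ Suc k"]
      unfolding converges_in_measure_on_def X_def by blast+
    then have "\<forall>\<^sub>F d in sequentially. d \<ge> d0 \<and> X k d \<in> lmeasurable \<and> measure lebesgue (X k d) < e / 2 * (1/2) ^ Suc k"
      using eventually_ge_at_top[of d0] by eventually_elim simp
    then show ?thesis by (rule eventually_happens'[OF sequentially_bot])
  qed
  then obtain D where D: "\<And>k. D k \<ge> d0" "\<And>k. X k (D k) \<in> lmeasurable"
      "\<And>k. measure lebesgue (X k (D k)) < e / 2 * (1/2) ^ Suc k"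
    by metis
  define A where "A = (\<Union>k. X k (D k))"
  have bound: "measure lebesgue (\<Union>k\<le>n. X k (D k)) \<le> e / 2" for n
  proof -
    have "measure lebesgue (\<Union>k\<le>n. X k (D k)) \<le> (\<Sum>k\<le>n. measure lebesgue (X k (D k)))"
      by (rule measure_UNION_le) (simp_all add: fmeasurableD[OF D(2)])
    also have "\<dots> \<le> (\<Sum>k\<le>n. e / 2 * (1/2) ^ Suc k)" by (intro sum_mono less_imp_le D(3))
    also have "\<dots> \<le> e / 2"
    proof -
      have "(\<Sum>k\<le>n. (1/2::real) ^ Suc k) = 1 - (1/2) ^ Suc n"
        by (induction n) (simp_all add: field_simps)
      then have "(\<Sum>k\<le>n. e / 2 * (1/2) ^ Suc k) = e / 2 * (1 - (1/2) ^ Suc n)"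
        by (simp only: sum_distrib_left[symmetric])
      also have "\<dots> \<le> e / 2 * 1" using e by (intro mult_left_mono) simp_all
      finally show ?thesis by simp
    qed
    finally show ?thesis .
  qed
  have "A \<in> lmeasurable" "measure lebesgue A \<le> e / 2"
    unfolding A_def
    using fmeasurable_countable_Union[OF D(2) bound] measure_countable_Union_le[OF D(2) bound] by simp_all
  moreover have "A \<subseteq> S" by (auto simp: A_def X_def)
  moreover have "uniform_limit (S - A) f l sequentially"
  proof (rule uniform_limitI)
    fix \<delta> :: real assume "\<delta> > 0"
    then obtain k where k: "1 / real (Suc k) < \<delta>" using nat_approx_posE by blast
    have "dist (f d x) (l x) < \<delta>" if d: "d \<ge> D k" and x: "x \<in> S - A" for d x
    proof -
      have "f (D k) x \<le> f d x"
        using d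
      proof (induction rule: dec_induct)
        case (step m)
        then show ?case using mono x D(1)[of k] unfolding nondecreasing_from_on_def
          by (meson Diff_iff order_trans)
      qed simp
      moreover have "\<bar>l x - f (D k) x\<bar> < 1 / real (Suc k)" using x by (auto simp: A_def X_def not_le)
      moreover have "f d x \<le> l x" using le[of d x] d D(1)[of k] x by simp
      ultimately show ?thesis using k by (simp add: dist_real_def)
    qed
    then show "\<forall>\<^sub>F d in sequentially. \<forall>x\<in>S - A. dist (f d x) (l x) < \<delta>"
      unfolding eventually_sequentially by blast
  qed
  ultimately show "\<exists>A\<subseteq>S. A \<in> lmeasurable \<and> measure lebesgue A < e \<and> uniform_limit (S - A) f l sequentially"
    using e by (intro exI[of _ A]) simp
qed

lemma almost_uniformly_imp_AE:
  fixes f :: "nat \<Rightarrow> 'a::euclidean_space \<Rightarrow> real"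
  assumes "converges_almost_uniformly_on S f l"
  shows "converges_AE_on S f l"
proof -
  let ?N = "{x\<in>S. \<not> (\<lambda>d. f d x) \<longlonglongrightarrow> l x}"
  have "negligible ?N"
    unfolding negligible_outer
  proof (intro allI impI)
    fix e :: real assume "e > 0"
    then obtain A where A: "A \<in> lmeasurable" "measure lebesgue A < e" "uniform_limit (S - A) f l sequentially"
      using assms unfolding converges_almost_uniformly_on_def by blast
    have "?N \<subseteq> A" using tendsto_uniform_limitI[OF A(3)] by blast
    with A show "\<exists>T. ?N \<subseteq> T \<and> T \<in> lmeasurable \<and> measure lebesgue T < e" by blast
  qed
  then have "AE x in lebesgue. x \<notin> ?N" unfolding negligible_iff_null_sets by (rule AE_not_in)
  then show ?thesis unfolding converges_AE_on_def by (rule AE_mp) simp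
qed

section \<open>Continuity of the minimal eigenvalue function\<close>

text \<open>By uniform continuity, moving \<open>x\<close> slightly changes \<open>q x y\<close> by little for all \<open>y\<close> at once, so a minimizer
for one point is nearly optimal for a neighbouring point.\<close>

lemma continuous_on_INF_compact:
  fixes q :: "'a::metric_space \<Rightarrow> 'b::metric_space \<Rightarrow> real"
  assumes X: "compact X" and Y: "compact Y"
    and q: "continuous_on (X \<times> Y) (\<lambda>(x, y). q x y)"
    and attained: "\<And>x. x \<in> X \<Longrightarrow> \<exists>y\<in>Y. m x = q x y \<and> (\<forall>y'\<in>Y. q x y \<le> q x y')"
  shows "continuous_on X m"
  unfolding continuous_on_iff
proof (intro ballI allI impI)
  fix x e assume x: "x \<in> X" and e: "(e::real) > 0"
  have "uniformly_continuous_on (X \<times> Y) (\<lambda>(x, y). q x y)"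
    using q X Y by (intro compact_uniformly_continuous compact_Times)
  then obtain d where d: "d > 0" "\<And>w w'. w \<in> X \<times> Y \<Longrightarrow> w' \<in> X \<times> Y \<Longrightarrow> dist w' w < d \<Longrightarrow>
      dist ((\<lambda>(x, y). q x y) w') ((\<lambda>(x, y). q x y) w) < e"
    using e unfolding uniformly_continuous_on_def by metis
  have close: "m x1 < m x2 + e" if x12: "x1 \<in> X" "x2 \<in> X" "dist x1 x2 < d" for x1 x2
  proof -
    obtain y where y: "y \<in> Y" "m x2 = q x2 y" using attained[OF x12(2)] by blast
    have "m x1 \<le> q x1 y" using attained[OF x12(1)] y(1) by auto
    also have "\<dots> < q x2 y + e"
      using d(2)[of "(x2, y)" "(x1, y)"] x12 y(1) by (simp add: dist_Pair_Pair dist_real_def)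
    finally show ?thesis using y(2) by simp
  qed
  have "dist (m x') (m x) < e" if "x' \<in> X" "dist x' x < d" for x'
    using close[of x' x] close[of x x'] that x by (simp add: dist_commute dist_real_def abs_less_iff)
  then show "\<exists>d>0. \<forall>x'\<in>X. dist x' x < d \<longrightarrow> dist (m x') (m x) < e" using d(1) by blast
qed

lemma lambda_min_le:
  fixes P :: "('n::finite, 'p::finite, 'm::finite) pmat"
  assumes U: "compact U" "U \<noteq> {}" "u \<in> U" "v \<bullet> v = 1"
  shows "lambda_min P U x \<le> v \<bullet> (mat_eval P x u *v v)"
proof -
  have "v \<in> unit_vectors" using U(4) by (simp add: unit_vectors_def)
  then show ?thesis using lambda_min_attained[OF U(1,2), of P x] U(3) by auto
qed

lemma continuous_on_lambda_min:
  fixes P :: "('n::finite, 'p::finite, 'm::finite) pmat"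
  assumes "compact X" "compact U" "U \<noteq> {}"
  shows "continuous_on X (lambda_min P U)"
proof (rule continuous_on_INF_compact[OF assms(1) compact_Times[OF assms(2) compact_unit_vectors],
      of "\<lambda>x w. snd w \<bullet> (mat_eval P x (fst w) *v snd w)"])
  show "continuous_on (X \<times> (U \<times> unit_vectors)) (\<lambda>(x, w). snd w \<bullet> (mat_eval P x (fst w) *v snd w))"
    using continuous_on_subset[OF continuous_on_mat_eval_form[of P] subset_UNIV]
    by (simp add: case_prod_beta)
  show "\<exists>w\<in>U \<times> unit_vectors. lambda_min P U x = snd w \<bullet> (mat_eval P x (fst w) *v snd w) \<and>
      (\<forall>w'\<in>U \<times> unit_vectors. snd w \<bullet> (mat_eval P x (fst w) *v snd w) \<le> snd w' \<bullet> (mat_eval P x (fst w') *v snd w'))"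
    for x
    using lambda_min_attained[OF assms(2,3), of P x] by fastforce
qed

section \<open>The semidefinite programs\<close>

definition part_x :: "real^('n::finite + 'p::finite + 'm::finite) \<Rightarrow> real^'n" where "part_x w = (\<chi> i. w $ Inl i)"
definition part_u :: "real^('n::finite + 'p::finite + 'm::finite) \<Rightarrow> real^'p" where "part_u w = (\<chi> i. w $ Inr (Inl i))"
definition part_v :: "real^('n::finite + 'p::finite + 'm::finite) \<Rightarrow> real^'m" where "part_v w = (\<chi> i. w $ Inr (Inr i))"
definition join :: "real^'n::finite \<Rightarrow> real^'p::finite \<Rightarrow> real^'m::finite \<Rightarrow> real^('n + 'p + 'm)" where
  "join x u v = (\<chi> k. vars3 x u v k)"

lemma part_join [simp]:
  "part_x (join x u v) = x" "part_u (join x u v) = u" "part_v (join x u v) = v"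
  by (simp_all add: part_x_def part_u_def part_v_def join_def vec_eq_iff)

lemma nth_join: "($) (join x u v) = vars3 x u v"
  by (rule ext) (simp add: join_def)

lemma inner_parts: "w \<bullet> w = part_x w \<bullet> part_x w + part_u w \<bullet> part_u w + part_v w \<bullet> part_v w"
  for w :: "real^('n::finite + 'p::finite + 'm::finite)"
proof -
  have "w \<bullet> w = (\<Sum>k\<in>UNIV <+> (UNIV <+> UNIV). w $ k * w $ k)"
    by (simp add: inner_vec_def)
  also have "\<dots> = part_x w \<bullet> part_x w + (part_u w \<bullet> part_u w + part_v w \<bullet> part_v w)"
    by (subst sum.Plus, simp, simp, subst sum.Plus)
       (simp_all add: inner_vec_def part_x_def part_u_def part_v_def)
  finally show ?thesis by simp
qed

lemma real_polynomial_function_parts: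
  "real_polynomial_function (\<lambda>w. part_x w $ i)" "real_polynomial_function (\<lambda>w. part_u w $ j)"
  "real_polynomial_function (\<lambda>w. part_v w $ l)"
  by (simp_all add: part_x_def part_u_def part_v_def real_polynomial_function_nth)

lemma real_polynomial_function_form:
  fixes P :: "('n::finite, 'p::finite, 'm::finite) pmat"
  shows "real_polynomial_function (\<lambda>w. part_v w \<bullet> (mat_eval P (part_x w) (part_u w) *v part_v w))"
proof -
  have vars: "real_polynomial_function (\<lambda>w. vars2 (part_x w) (part_u w) k)" for k :: "'n + 'p"
    by (cases k) (simp_all add: real_polynomial_function_parts)
  show ?thesis
    unfolding inner_vec_def matrix_vector_mult_def mat_eval_def
    by (simp, intro real_polynomial_function_sum real_polynomial_function.intros(4)
        real_polynomial_function_peval vars real_polynomial_function_parts finite_class.finite_UNIV)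
qed

lemma sos_upto_of_degree:
  assumes "tdeg (\<Sum>q\<leftarrow>qs. q\<^sup>2) \<le> 2 * d"
  shows "(\<Sum>q\<leftarrow>qs. q\<^sup>2) \<in> sos_upto d"
  using assms unfolding sos_upto_def by blast

text \<open>The gap between the quadratic form and \<open>q\<close> is positive on the compact set of all \<open>(x, u, v)\<close> with
\<open>x\<close> and \<open>u\<close> in the given sets and \<open>v\<close> on the unit sphere. Adding the two ball constraints and the
equation of the sphere yields a ball constraint for the joint variable, so Putinar's theorem gives a
certificate of some finite degree. The degree bounds of the programs grow with \<open>d\<close> and eventually
admit this certificate.\<close>

lemma eventually_feasible:
  fixes P :: "('n::finite, 'p::finite, 'm::finite) pmat"
    and a :: "nat \<Rightarrow> 'p rpoly" and b :: "nat \<Rightarrow> 'n rpoly" and q :: "'n rpoly"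
  assumes a0: "a 0 = 1"
    and U_ball: "\<exists>i\<in>{1..na}. \<forall>u::real^'p. peval (a i) (($) u) = R\<^sup>2 - u \<bullet> u"
    and B_ball: "\<exists>j\<in>{1..nb}. \<forall>x::real^'n. peval (b j) (($) x) = R\<^sup>2 - x \<bullet> x"
    and dr_ge: "\<forall>d\<ge>d0. int (dr d) \<ge> int d - 1"
    and ds_ge: "\<forall>d\<ge>d0. \<forall>i\<in>{0..na}. int (ds d i) \<ge> int d - \<lceil>real (tdeg (a i)) / 2\<rceil>"
    and dt_ge: "\<forall>d\<ge>d0. \<forall>j\<in>{1..nb}. int (dt d j) \<ge> int d - \<lceil>real (tdeg (b j)) / 2\<rceil>"
    and below: "\<And>x u v. x \<in> nonneg_set nb b \<Longrightarrow> u \<in> nonneg_set na a \<Longrightarrow> v \<bullet> v = 1 \<Longrightarrow>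
      peval q (($) x) < v \<bullet> (mat_eval P x u *v v)"
  shows "\<forall>\<^sub>F d in sequentially. \<exists>r s t. sdp_feasible P na a nb b d (dr d) (ds d) (dt d) q r s t"
proof -
  define I where "I = {0..na} <+> {1..nb}"
  define G :: "nat + nat \<Rightarrow> real^('n + 'p + 'm) \<Rightarrow> real" where
    "G = case_sum (\<lambda>i w. peval (a i) (($) (part_u w))) (\<lambda>j w. peval (b j) (($) (part_x w)))"
  define e :: "real^('n + 'p + 'm) \<Rightarrow> real" where "e w = 1 - part_v w \<bullet> part_v w" for w
  define F :: "real^('n + 'p + 'm) \<Rightarrow> real" where
    "F w = part_v w \<bullet> (mat_eval P (part_x w) (part_u w) *v part_v w) - peval q (($) (part_x w))" for w
  have I: "finite I" "Inl 0 \<in> I" "\<And>w. G (Inl 0) w = 1"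
    by (simp_all add: I_def G_def a0 InlI)
  note qm = certificates_quadratic_module[where g = G and e = e, OF I]
  have "F \<in> certificates e I G"
  proof (rule putinar_certificate[where g = G, OF I])
    show "real_polynomial_function (G i)" for i
      by (cases i) (simp_all add: G_def real_polynomial_function_peval real_polynomial_function_parts)
    show "real_polynomial_function e"
      unfolding e_def inner_vec_def
      by (simp, intro real_polynomial_function_diff real_polynomial_function.intros(2,4)
          real_polynomial_function_sum real_polynomial_function_parts finite_class.finite_UNIV)
    show "real_polynomial_function F"
      unfolding F_def
      by (intro real_polynomial_function_diff real_polynomial_function_form
          real_polynomial_function_peval real_polynomial_function_parts)
    obtain i j where i: "i \<in> {1..na}" "\<And>u::real^'p. peval (a i) (($) u) = R\<^sup>2 - u \<bullet> u"
      and j: "j \<in> {1..nb}" "\<And>x::real^'n. peval (b j) (($) x) = R\<^sup>2 - x \<bullet> x"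
      using U_ball B_ball by blast
    have "Inl i \<in> I" "Inr j \<in> I" using i(1) j(1) by (auto simp: I_def)
    then have "G (Inl i) \<in> certificates e I G" "G (Inr j) \<in> certificates e I G"
      by (simp_all add: certificates_inequality I(1))
    \<comment> \<open>The squared radius of the joint ball is the sum of those for \<open>x\<close>, \<open>u\<close> and \<open>v\<close>.\<close>
    from quadratic_module_add[OF qm quadratic_module_add[OF qm this]
        certificates_equation[OF real_polynomial_function.intros(2)[of 1]]]
    have "(\<lambda>w. G (Inl i) w + G (Inr j) w + 1 * e w) \<in> certificates e I G" .
    also have "(\<lambda>w. G (Inl i) w + G (Inr j) w + 1 * e w) = (\<lambda>w. (2 * R\<^sup>2 + 1) - w \<bullet> w)"
      by (rule ext) (simp add: G_def e_def i(2) j(2) inner_parts)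
    finally show "(\<lambda>w. (2 * R\<^sup>2 + 1) - w \<bullet> w) \<in> certificates e I G" .
    fix w assume e0: "e w = 0" and nonneg: "\<And>i. i \<in> I \<Longrightarrow> 0 \<le> G i w"
    have "0 \<le> peval (b j) (($) (part_x w))" if "j \<in> {1..nb}" for j
      using nonneg[of "Inr j"] InrI[OF that, of "{0..na}"] unfolding I_def G_def sum.case by blast
    then have "part_x w \<in> nonneg_set nb b" unfolding nonneg_set_def by blast
    moreover have "0 \<le> peval (a i) (($) (part_u w))" if "i \<in> {1..na}" for i
      using nonneg[of "Inl i"] InlI[of i "{0..na}" "{1..nb}"] that
      unfolding I_def G_def sum.case by simp
    then have "part_u w \<in> nonneg_set na a" unfolding nonneg_set_def by blast
    ultimately show "0 < F w" using below[of "part_x w" "part_u w" "part_v w"] e0 by (simp add: F_def e_def)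
  qed
  then obtain r' s' where r': "real_polynomial_function r'" and s': "\<And>i. i \<in> I \<Longrightarrow> s' i \<in> sos_functions"
    and F: "F = (\<lambda>w. r' w * e w + (\<Sum>i\<in>I. s' i w * G i w))"
    unfolding certificates_def by blast
  obtain r where r: "\<And>w. r' w = peval r (($) w)"
    using real_polynomial_function_imp_peval[OF r'] by blast
  have "\<forall>i\<in>I. \<exists>qs. \<forall>w. s' i w = peval (\<Sum>q\<leftarrow>qs. q\<^sup>2) (($) w)"
    using s' sos_functions_imp_peval by blast
  then obtain Q where Q: "\<And>i w. i \<in> I \<Longrightarrow> s' i w = peval (\<Sum>q\<leftarrow>Q i. q\<^sup>2) (($) w)"
    by (metis bchoice)
  define s where "s i = (\<Sum>q\<leftarrow>Q (Inl i). q\<^sup>2)" for i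
  define t where "t j = (\<Sum>q\<leftarrow>Q (Inr j). q\<^sup>2)" for j
  have identity: "v \<bullet> (mat_eval P x u *v v) - peval q (($) x) =
        peval r (vars3 x u v) * (1 - v \<bullet> v)
        + (\<Sum>i=0..na. peval (s i) (vars3 x u v) * peval (a i) (($) u))
        + (\<Sum>j=1..nb. peval (t j) (vars3 x u v) * peval (b j) (($) x))" for x u v
  proof -
    have "v \<bullet> (mat_eval P x u *v v) - peval q (($) x) = F (join x u v)" by (simp add: F_def)
    also have "\<dots> = r' (join x u v) * e (join x u v) + (\<Sum>i\<in>I. s' i (join x u v) * G i (join x u v))"
      by (simp only: F)
    also have "(\<Sum>i\<in>I. s' i (join x u v) * G i (join x u v))
        = (\<Sum>i\<in>I. peval (\<Sum>q\<leftarrow>Q i. q\<^sup>2) (vars3 x u v) * G i (join x u v))"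
      by (rule sum.cong) (simp_all add: Q nth_join)
    also have "\<dots> = (\<Sum>i=0..na. peval (s i) (vars3 x u v) * peval (a i) (($) u))
        + (\<Sum>j=1..nb. peval (t j) (vars3 x u v) * peval (b j) (($) x))"
      unfolding I_def by (subst sum.Plus) (simp_all add: G_def s_def t_def)
    finally show ?thesis by (simp add: r nth_join e_def add.assoc)
  qed
  \<comment> \<open>An index beyond which every degree bound admits the multipliers found; the summand 1 accounts for
     the bound \<open>d - 1\<close> on \<open>dr d\<close>.\<close>
  define D where "D = d0 + tdeg q + tdeg r + 1 + (\<Sum>i=0..na. tdeg (s i) + tdeg (a i))
    + (\<Sum>j=1..nb. tdeg (t j) + tdeg (b j))"
  have ceil: "\<lceil>real n / 2\<rceil> \<le> int n" for n by (simp add: ceiling_le_iff)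
  have "sdp_feasible P na a nb b d (dr d) (ds d) (dt d) q r s t" if d: "d \<ge> D" for d
    unfolding sdp_feasible_def
  proof (intro conjI ballI allI identity)
    have d0: "d \<ge> d0" using d by (simp add: D_def)
    show "q \<in> polys_upto (2 * d)" using d by (simp add: D_def polys_upto_def)
    have "int d - 1 \<le> int (dr d)" using dr_ge d0 by blast
    then show "r \<in> polys_upto (2 * dr d)" using d by (simp add: D_def polys_upto_def)
    fix i assume i: "i \<in> {0..na}"
    have "tdeg (s i) + tdeg (a i) \<le> (\<Sum>i=0..na. tdeg (s i) + tdeg (a i))"
      by (rule member_le_sum[OF i]) simp_all
    then have "tdeg (s i) + tdeg (a i) \<le> d" using d by (simp add: D_def)
    moreover have "int d - \<lceil>real (tdeg (a i)) / 2\<rceil> \<le> int (ds d i)" using ds_ge d0 i by blast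
    ultimately have "tdeg (s i) \<le> 2 * ds d i" using ceil[of "tdeg (a i)"] by linarith
    then show "s i \<in> sos_upto (ds d i)" unfolding s_def by (rule sos_upto_of_degree)
  next
    have d0: "d \<ge> d0" using d by (simp add: D_def)
    fix j assume j: "j \<in> {1..nb}"
    have "tdeg (t j) + tdeg (b j) \<le> (\<Sum>j=1..nb. tdeg (t j) + tdeg (b j))"
      by (rule member_le_sum[OF j]) simp_all
    then have "tdeg (t j) + tdeg (b j) \<le> d" using d by (simp add: D_def)
    moreover have "int d - \<lceil>real (tdeg (b j)) / 2\<rceil> \<le> int (dt d j)" using dt_ge d0 j by blast
    ultimately have "tdeg (t j) \<le> 2 * dt d j" using ceil[of "tdeg (b j)"] by linarith
    then show "t j \<in> sos_upto (dt d j)" unfolding t_def by (rule sos_upto_of_degree)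
  qed
  then show ?thesis unfolding eventually_sequentially by blast
qed

text \<open>The identity of the program is evaluated at a minimizing pair \<open>(u, v)\<close>: the term with \<open>r\<close> vanishes
and all other terms are nonnegative.\<close>

lemma feasible_le_lambda_min:
  fixes P :: "('n::finite, 'p::finite, 'm::finite) pmat"
  assumes feasible: "sdp_feasible P na a nb b d dr ds dt g r s t" and a0: "a 0 = 1"
    and U: "U = nonneg_set na a" "compact U" "U \<noteq> {}" and x: "x \<in> nonneg_set nb b"
  shows "peval g (($) x) \<le> lambda_min P U x"
proof -
  obtain u v where u: "u \<in> U" and v: "v \<bullet> v = 1"
    and lam: "lambda_min P U x = v \<bullet> (mat_eval P x u *v v)"
    using lambda_min_attained[OF U(2,3), of P x] unfolding unit_vectors_def by blast
  have s: "0 \<le> peval (s i) (vars3 x u v) * peval (a i) (($) u)" if "i \<in> {0..na}" for i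
  proof (rule mult_nonneg_nonneg)
    have "s i \<in> sos_upto (ds i)" using feasible that unfolding sdp_feasible_def by blast
    then obtain qs where "s i = (\<Sum>q\<leftarrow>qs. q\<^sup>2)" unfolding sos_upto_def by blast
    then show "0 \<le> peval (s i) (vars3 x u v)" by (simp add: peval_sos_nonneg)
    show "0 \<le> peval (a i) (($) u)"
      using u a0 that unfolding U(1) nonneg_set_def by (cases "i = 0") simp_all
  qed
  have t: "0 \<le> peval (t j) (vars3 x u v) * peval (b j) (($) x)" if "j \<in> {1..nb}" for j
  proof (rule mult_nonneg_nonneg)
    have "t j \<in> sos_upto (dt j)" using feasible that unfolding sdp_feasible_def by blast
    then obtain qs where "t j = (\<Sum>q\<leftarrow>qs. q\<^sup>2)" unfolding sos_upto_def by blast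
    then show "0 \<le> peval (t j) (vars3 x u v)" by (simp add: peval_sos_nonneg)
    show "0 \<le> peval (b j) (($) x)" using x that unfolding nonneg_set_def by blast
  qed
  have "lambda_min P U x - peval g (($) x) = peval r (vars3 x u v) * (1 - v \<bullet> v)
        + (\<Sum>i=0..na. peval (s i) (vars3 x u v) * peval (a i) (($) u))
        + (\<Sum>j=1..nb. peval (t j) (vars3 x u v) * peval (b j) (($) x))"
    using feasible unfolding sdp_feasible_def lam by blast
  moreover have "0 \<le> (\<Sum>i=0..na. peval (s i) (vars3 x u v) * peval (a i) (($) u))"
    by (rule sum_nonneg[OF s])
  moreover have "0 \<le> (\<Sum>j=1..nb. peval (t j) (vars3 x u v) * peval (b j) (($) x))"
    by (rule sum_nonneg[OF t])
  ultimately show ?thesis using v by simp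
qed

lemma continuous_on_peval_nth: "continuous_on S (\<lambda>x. peval p (($) x))"
  by (intro continuous_on_peval continuous_intros)

lemma running_max_Suc:
  assumes "d \<ge> d0"
  shows "running_max d0 g (Suc d) x = max (running_max d0 g d x) (peval (g (Suc d)) (($) x))"
proof -
  have "{d0..Suc d} = insert (Suc d) {d0..d}" using assms by auto
  then show ?thesis using assms by (simp add: running_max_def max.commute)
qed

lemma continuous_on_running_max:
  assumes "d \<ge> d0"
  shows "continuous_on S (running_max d0 g d)"
  using assms
proof (induction rule: dec_induct)
  case base
  then show ?case by (simp add: running_max_def continuous_on_peval_nth)
next
  case (step d)
  then show ?case
    by (subst continuous_on_cong[OF refl running_max_Suc]) (auto intro!: continuous_intros continuous_on_peval_nth)
qed

text \<open>Since \<open>peval (g d)\<close> stays below \<open>lam\<close>, its \<open>L1\<close> distance from \<open>lam\<close> is the integral of \<open>lam\<close> minus the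
objective value. By optimality that objective value is eventually at least that of any polynomial
strictly below \<open>lam\<close>, and by Stone--Weierstrass such polynomials come arbitrarily close to \<open>lam\<close>.\<close>

lemma optimal_L1_convergence:
  fixes P :: "('n::finite, 'p::finite, 'm::finite) pmat" and g :: "nat \<Rightarrow> 'n rpoly"
  assumes B_def: "B = nonneg_set nb b" and B: "compact B" and lam: "continuous_on B lam"
    and below: "\<And>d x. d \<ge> d0 \<Longrightarrow> x \<in> B \<Longrightarrow> peval (g d) (($) x) \<le> lam x"
    and feasible: "\<And>q. (\<And>x. x \<in> B \<Longrightarrow> peval q (($) x) < lam x) \<Longrightarrow>
      \<forall>\<^sub>F d in sequentially. \<exists>r s t. sdp_feasible P na a nb b d (dr d) (ds d) (dt d) q r s t"
    and optimal: "\<And>d. d \<ge> d0 \<Longrightarrow> sdp_optimal P na a nb b d (dr d) (ds d) (dt d) (g d) (r d) (s d) (t d)"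
  shows "converges_L1_on B (\<lambda>d x. peval (g d) (($) x)) lam"
  unfolding converges_L1_on_def
proof
  have int: "set_integrable lebesgue B lam" "set_integrable lebesgue B (\<lambda>x. peval p (($) x))" for p
    by (intro set_integrable_continuous_compact B lam continuous_on_peval_nth)+
  then show "\<forall>\<^sub>F d in sequentially. set_integrable lebesgue B (\<lambda>x. lam x - peval (g d) (($) x))"
    by simp
  show "(\<lambda>d. LINT x:B|lebesgue. \<bar>lam x - peval (g d) (($) x)\<bar>) \<longlonglongrightarrow> 0"
  proof (rule order_tendstoI)
    fix e :: real assume "e < 0"
    then show "\<forall>\<^sub>F d in sequentially. e < (LINT x:B|lebesgue. \<bar>lam x - peval (g d) (($) x)\<bar>)"
      by (intro always_eventually allI less_le_trans[OF \<open>e < 0\<close>])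
         (simp add: set_lebesgue_integral_def)
  next
    fix e :: real assume e: "0 < e"
    let ?vol = "measure lebesgue B"
    define \<eta> where "\<eta> = e / (2 * ?vol + 1)"
    have \<eta>: "\<eta> > 0" unfolding \<eta>_def using e by (intro divide_pos_pos add_nonneg_pos) simp_all
    have vol: "2 * \<eta> * ?vol < e"
    proof -
      have "0 < 2 * ?vol + 1" by (intro add_nonneg_pos) simp_all
      then show ?thesis using e by (simp add: \<eta>_def field_simps)
    qed
    \<comment> \<open>Approximating the function lowered by \<open>\<eta>\<close> up to \<open>\<eta>\<close> keeps the approximant strictly below it.\<close>
    obtain p where p: "real_polynomial_function p" "\<And>x. x \<in> B \<Longrightarrow> \<bar>(lam x - \<eta>) - p x\<bar> < \<eta>"
      using Stone_Weierstrass_real_polynomial_function[OF B continuous_on_diff[OF lam continuous_on_const] \<eta>] by blast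
    obtain q where q: "\<And>x. p x = peval q (($) x)"
      using real_polynomial_function_imp_peval[OF p(1)] by blast
    have q_bounds: "peval q (($) x) < lam x" "lam x - peval q (($) x) \<le> 2 * \<eta>" if "x \<in> B" for x
      using p(2)[OF that] by (auto simp: q abs_less_iff)
    have "\<forall>\<^sub>F d in sequentially. \<exists>r s t. sdp_feasible P na a nb b d (dr d) (ds d) (dt d) q r s t"
      by (rule feasible) (rule q_bounds(1))
    then show "\<forall>\<^sub>F d in sequentially. (LINT x:B|lebesgue. \<bar>lam x - peval (g d) (($) x)\<bar>) < e"
      using eventually_ge_at_top[of d0]
    proof eventually_elim
      case (elim d)
      then have obj: "sdp_objective B q \<le> sdp_objective B (g d)"
        using optimal[OF elim(2)] unfolding sdp_optimal_def B_def by blast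
      have "(LINT x:B|lebesgue. \<bar>lam x - peval (g d) (($) x)\<bar>) \<le> (LINT x:B|lebesgue. lam x - peval (g d) (($) x))"
        using below[OF elim(2)]
        by (intro set_integral_mono_continuous B continuous_intros lam continuous_on_peval_nth) simp
      also have "\<dots> = (LINT x:B|lebesgue. lam x) - sdp_objective B (g d)"
        unfolding sdp_objective_def by (rule set_integral_diff(2)[OF int])
      also have "\<dots> \<le> (LINT x:B|lebesgue. lam x) - sdp_objective B q" using obj by simp
      also have "\<dots> = (LINT x:B|lebesgue. lam x - peval q (($) x))"
        unfolding sdp_objective_def by (rule set_integral_diff(2)[OF int, symmetric])
      also have "\<dots> \<le> (LINT x:B|lebesgue. 2 * \<eta>)"
        using q_bounds(2)
        by (intro set_integral_mono_continuous B continuous_intros lam continuous_on_peval_nth)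
      also have "\<dots> = 2 * \<eta> * ?vol"
        using lmeasurable_compact[OF B] by (simp add: set_lebesgue_integral_def fmeasurableD)
      finally show ?case using vol by simp
    qed
  qed
qed

theorem theorem1:
  fixes P :: "('n::finite, 'p::finite, 'm::finite) pmat"
    and a :: "nat \<Rightarrow> 'p rpoly" and na :: nat and U :: "(real^'p) set"
    and b :: "nat \<Rightarrow> 'n rpoly" and nb :: nat and B :: "(real^'n) set"
    and R :: real and d0 :: nat
    and dr :: "nat \<Rightarrow> nat" and ds dt :: "nat \<Rightarrow> nat \<Rightarrow> nat"
    and g :: "nat \<Rightarrow> 'n rpoly" and r :: "nat \<Rightarrow> ('n + 'p + 'm) rpoly"
    and s t :: "nat \<Rightarrow> nat \<Rightarrow> ('n + 'p + 'm) rpoly"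
  assumes P_sym: "transpose P = P"
    and a0: "a 0 = 1"
    and U_def: "U = nonneg_set na a"
    and U_nonempty: "U \<noteq> {}"
    and U_compact: "compact U"
    and U_ball: "\<exists>i\<in>{1..na}. \<forall>u::real^'p. peval (a i) (($) u) = R\<^sup>2 - u \<bullet> u"
    and P_bounded: "bounded (robust_set P U)"
    and B_def: "B = nonneg_set nb b"
    and B_compact: "compact B"
    and P_sub_B: "robust_set P U \<subseteq> B"
    and B_ball: "\<exists>j\<in>{1..nb}. \<forall>x::real^'n. peval (b j) (($) x) = R\<^sup>2 - x \<bullet> x"
    and d0_P: "2 + mat_deg P \<le> 2 * d0"
    and d0_a: "\<forall>i\<in>{1..na}. tdeg (a i) \<le> 2 * d0"
    and d0_b: "\<forall>j\<in>{1..nb}. tdeg (b j) \<le> 2 * d0"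
    and dr_ge: "\<forall>d\<ge>d0. int (dr d) \<ge> int d - 1"
    and ds_ge: "\<forall>d\<ge>d0. \<forall>i\<in>{0..na}. int (ds d i) \<ge> int d - \<lceil>real (tdeg (a i)) / 2\<rceil>"
    and dt_ge: "\<forall>d\<ge>d0. \<forall>j\<in>{1..nb}. int (dt d j) \<ge> int d - \<lceil>real (tdeg (b j)) / 2\<rceil>"
    and optimal: "\<forall>d\<ge>d0.
      sdp_optimal P na a nb b d (dr d) (ds d) (dt d) (g d) (r d) (s d) (t d)"
  shows "converges_L1_on B (\<lambda>d x. peval (g d) (($) x)) (lambda_min P U) \<and>
    converges_in_measure_on B (\<lambda>d x. peval (g d) (($) x)) (lambda_min P U) \<and>
    nondecreasing_from_on d0 B (running_max d0 g) \<and>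
    converges_AE_on B (running_max d0 g) (lambda_min P U) \<and>
    converges_almost_uniformly_on B (running_max d0 g) (lambda_min P U) \<and>
    converges_in_measure_on B (running_max d0 g) (lambda_min P U)"
proof -
  have lam: "continuous_on B (lambda_min P U)"
    by (rule continuous_on_lambda_min[OF B_compact U_compact U_nonempty])
  have below: "peval (g d) (($) x) \<le> lambda_min P U x" if "d \<ge> d0" "x \<in> B" for d x
    using optimal that(1) feasible_le_lambda_min[OF _ a0 U_def U_compact U_nonempty that(2)[unfolded B_def]]
    unfolding sdp_optimal_def by blast
  have L1: "converges_L1_on B (\<lambda>d x. peval (g d) (($) x)) (lambda_min P U)"
  proof (rule optimal_L1_convergence[OF B_def B_compact lam below _ optimal[rule_format]])
    fix q :: "'n rpoly"
    assume q: "\<And>x. x \<in> B \<Longrightarrow> peval q (($) x) < lambda_min P U x"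
    show "\<forall>\<^sub>F d in sequentially. \<exists>r s t. sdp_feasible P na a nb b d (dr d) (ds d) (dt d) q r s t"
    proof (rule eventually_feasible[OF a0 U_ball B_ball dr_ge ds_ge dt_ge])
      fix x u v assume "x \<in> nonneg_set nb b" "u \<in> nonneg_set na a" "(v::real^'m) \<bullet> v = 1"
      then show "peval q (($) x) < v \<bullet> (mat_eval P x u *v v)"
        using q lambda_min_le[OF U_compact U_nonempty] unfolding U_def B_def by (meson less_le_trans)
    qed
  qed
  have meas: "converges_in_measure_on B (\<lambda>d x. peval (g d) (($) x)) (lambda_min P U)"
    by (rule converges_L1_imp_in_measure[OF B_compact lam continuous_on_peval_nth L1])
  have max_le: "running_max d0 g d x \<le> lambda_min P U x" if "d \<ge> d0" "x \<in> B" for d x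
    unfolding running_max_def using that below by (subst Max_le_iff) auto
  have max_ge: "peval (g d) (($) x) \<le> running_max d0 g d x" if "d \<ge> d0" for d x
    unfolding running_max_def using that by (intro Max_ge) auto
  have mono: "nondecreasing_from_on d0 B (running_max d0 g)"
    unfolding nondecreasing_from_on_def by (simp add: running_max_Suc)
  have max_meas: "converges_in_measure_on B (running_max d0 g) (lambda_min P U)"
  proof (rule converges_in_measure_mono[OF meas])
    fix d assume d: "d \<ge> d0"
    show "\<bar>lambda_min P U x - running_max d0 g d x\<bar> \<le> \<bar>lambda_min P U x - peval (g d) (($) x)\<bar>"
      if "x \<in> B" for x
      using max_le[OF d that] max_ge[OF d, of x] by simp
    show "{x\<in>B. e \<le> \<bar>lambda_min P U x - running_max d0 g d x\<bar>} \<in> lmeasurable" for e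
      by (intro lmeasurable_superlevel B_compact continuous_intros lam continuous_on_running_max d)
  qed
  have max_au: "converges_almost_uniformly_on B (running_max d0 g) (lambda_min P U)"
    by (rule monotone_in_measure_imp_almost_uniformly[OF mono max_le max_meas])
  show ?thesis
    using L1 meas mono almost_uniformly_imp_AE[OF max_au] max_au max_meas by blast
qed

end
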